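(* Let $\Sigma$ be a compact stationary graph over the horizontal hyperplane $x_{n+1}=0$ of $\mathbb{R}^{n+1}$, for $m>0$ (and constants $\eta\neq 0$, $\lambda\in\mathbb{R}$), with unit normal $\nu=(\nu_1,\ldots,\nu_{n+1})$. If $\eta\,\nu_{n+1}>0$ holds on $\Sigma$, then $\Sigma$ is stable. Moreover, $\Sigma$ is a minimizer of the energy $E_{\eta,m,\lambda}$ in the class of all graphs over $x_{n+1}=0$ and with the same boundary as $\Sigma$.
   Context: Here $n\ge 1$ and $(x_1,\ldots,x_{n+1})$ are Cartesian coordinates of $\mathbb{R}^{n+1}$. For an oriented hypersurface $\Sigma$ with unit normal $\nu$, the mean curvature $H$ is normalized so that $\Delta x_k=nH\nu_k$ on $\Sigma$, where $\Delta$ is the Laplacian of $\Sigma$; for a graph $x_{n+1}=f$ with normal $\nu=(1+|Df|^2)^{-1/2}(-Df,1)$ this means $nH=\mathrm{Div}_{\mathbb{R}^n}\left(Df/\sqrt{1+|Df|^2}\right)$. The vertical potential energy of $\Sigma$ is $$E_{\eta,m,\lambda}[\Sigma]=\int_\Sigma dA+\eta\int_\Omega x_{n+1}^m\,dV+\lambda\int_\Omega dV,$$ where $dA$ and $dV$ are the area and volume elements and, for a non-closed hypersurface, $\Omega$ is the domain between $\Sigma$ and the hyperplane $x_{n+1}=0$. If $m\notin\mathbb{N}$, hypersurfaces are assumed to be included in the upper half-space $x_{n+1}>0$. The first variation for compactly supported variations is $E'_{\eta,m,\lambda}(0)[u]=-\int_\Sigma\left(nH-(\eta x_{n+1}^m+\lambda)\right)u\,dA$,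 where $u$ is the normal component (along $\nu$) of the variation velocity. $\Sigma$ is stationary (for $\eta,m,\lambda$) if its mean curvature satisfies $nH=\eta x_{n+1}^m+\lambda$. A stationary graph is a stationary hypersurface that is a graph over (a domain of) $x_{n+1}=0$. A stationary hypersurface $\Sigma$ is stable if $E''_{\eta,m,\lambda}(0)[u]\ge 0$ for all $u\in\mathcal{C}_0^\infty(\Sigma)$ (smooth functions with compact support), where $$E''_{\eta,m,\lambda}(0)[u]=-\int_\Sigma u\,L[u]\,dA,\qquad L[u]=\Delta u+\left(|A|^2-m\eta x_{n+1}^{m-1}\nu_{n+1}\right)u,$$ and $|A|^2$ is the square of the norm of the second fundamental form of $\Sigma$.
   Formalization: For even m, the graph Σ and the competing graphs are assumed to lie in x_{n+1} ≥ 0, as the claim fails otherwise; the integrals over Ω are signed by the orientation ν, as the first variation requires; competing graphs are C^1 inside and of finite area. *)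

theory Defs
  imports "HOL-Analysis.Analysis"
begin

text \<open>
  The ambient space \<open>\<real>\<^sup>n\<^sup>+\<^sup>1\<close> is \<open>(real^'n) \<times> real\<close>: \<open>fst\<close> is the projection to the
  horizontal hyperplane and \<open>snd\<close> is the height \<open>x\<^sub>n\<^sub>+\<^sub>1\<close>.  A hypersurface is given by a
  parametrization \<open>X\<close> on an open set \<open>D\<close> (its interior points), and functions and
  fields on it are identified with their pullbacks to \<open>D\<close>.
\<close>

section \<open>Smoothness\<close>

definition pd :: "'n::finite \<Rightarrow> (real^'n \<Rightarrow> 'b::real_normed_vector) \<Rightarrow> real^'n \<Rightarrow> 'b" where
  "pd i F x = frechet_derivative F (at x) (axis i 1)"

text \<open>Meaningful for open \<open>S\<close>, as the derivatives are two-sided.\<close>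

primrec Ck_on :: "nat \<Rightarrow> (real^'n::finite) set \<Rightarrow> (real^'n \<Rightarrow> real) \<Rightarrow> bool" where
  "Ck_on 0 S f \<longleftrightarrow> continuous_on S f"
| "Ck_on (Suc k) S f \<longleftrightarrow> (\<forall>x\<in>S. f differentiable (at x)) \<and> (\<forall>i. Ck_on k S (pd i f))"

definition smooth_on :: "(real^'n::finite) set \<Rightarrow> (real^'n \<Rightarrow> real) \<Rightarrow> bool" where
  "smooth_on S f \<longleftrightarrow> (\<forall>k. Ck_on k S f)"

definition smooth_up_to_boundary :: "(real^'n::finite) set \<Rightarrow> (real^'n \<Rightarrow> real) \<Rightarrow> bool" where
  "smooth_up_to_boundary K f \<longleftrightarrow> (\<exists>U. open U \<and> K \<subseteq> U \<and> smooth_on U f)"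

definition test_function :: "(real^'n::finite) set \<Rightarrow> (real^'n \<Rightarrow> real) \<Rightarrow> bool" where
  "test_function D u \<longleftrightarrow>
     smooth_on UNIV u \<and> compact (closure {x. u x \<noteq> 0}) \<and> closure {x. u x \<noteq> 0} \<subseteq> D"


section \<open>Geometry of a parametrized hypersurface\<close>

definition metric :: "(real^'n::finite \<Rightarrow> (real^'n) \<times> real) \<Rightarrow> real^'n \<Rightarrow> real^'n^'n" where
  "metric X x = (\<chi> i j. pd i X x \<bullet> pd j X x)"

definition area_element :: "(real^'n::finite \<Rightarrow> (real^'n) \<times> real) \<Rightarrow> real^'n \<Rightarrow> real" where
  "area_element X x = sqrt (det (metric X x))"

definition second_form ::
  "(real^'n::finite \<Rightarrow> (real^'n) \<times> real) \<Rightarrow> (real^'n \<Rightarrow> (real^'n) \<times> real) \<Rightarrow> real^'n \<Rightarrow> real^'n^'n"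
where
  "second_form X \<nu> x = (\<chi> i j. pd i (pd j X) x \<bullet> \<nu> x)"

definition shape_operator ::
  "(real^'n::finite \<Rightarrow> (real^'n) \<times> real) \<Rightarrow> (real^'n \<Rightarrow> (real^'n) \<times> real) \<Rightarrow> real^'n \<Rightarrow> real^'n^'n"
where
  "shape_operator X \<nu> x = matrix_inv (metric X x) ** second_form X \<nu> x"

text \<open>With this normalization and sign, \<open>\<Delta> X = n H \<nu>\<close>.\<close>

definition mean_curvature ::
  "(real^'n::finite \<Rightarrow> (real^'n) \<times> real) \<Rightarrow> (real^'n \<Rightarrow> (real^'n) \<times> real) \<Rightarrow> real^'n \<Rightarrow> real"
where
  "mean_curvature X \<nu> x = trace (shape_operator X \<nu> x) / real CARD('n)"

definition second_form_norm_sq ::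
  "(real^'n::finite \<Rightarrow> (real^'n) \<times> real) \<Rightarrow> (real^'n \<Rightarrow> (real^'n) \<times> real) \<Rightarrow> real^'n \<Rightarrow> real"
where
  "second_form_norm_sq X \<nu> x = trace (shape_operator X \<nu> x ** shape_operator X \<nu> x)"

definition laplace_beltrami ::
  "(real^'n::finite \<Rightarrow> (real^'n) \<times> real) \<Rightarrow> (real^'n \<Rightarrow> real) \<Rightarrow> real^'n \<Rightarrow> real"
where
  "laplace_beltrami X u x =
     (\<Sum>i\<in>UNIV. pd i (\<lambda>y. area_element X y *
        (\<Sum>j\<in>UNIV. matrix_inv (metric X y) $ i $ j * pd j u y)) x) / area_element X x"


section \<open>Stationary and stable hypersurfaces\<close>

text \<open>For a natural exponent the power is defined at every height, with \<open>t\<^sup>0 = 1\<close> also at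
  \<open>t = 0\<close>; \<open>powr\<close> is only right for \<open>t > 0\<close>.\<close>

definition height_power :: "real \<Rightarrow> real \<Rightarrow> real" where
  "height_power t a = (if a \<in> \<nat> then t ^ nat \<lfloor>a\<rfloor> else t powr a)"

definition stationary ::
  "real \<Rightarrow> real \<Rightarrow> real \<Rightarrow> (real^'n::finite) set \<Rightarrow> (real^'n \<Rightarrow> (real^'n) \<times> real)
    \<Rightarrow> (real^'n \<Rightarrow> (real^'n) \<times> real) \<Rightarrow> bool"
where
  "stationary \<eta> m lam D X \<nu> \<longleftrightarrow>
     (\<forall>x\<in>D. real CARD('n) * mean_curvature X \<nu> x = \<eta> * height_power (snd (X x)) m + lam)"

definition jacobi_operator ::
  "real \<Rightarrow> real \<Rightarrow> (real^'n::finite \<Rightarrow> (real^'n) \<times> real)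
    \<Rightarrow> (real^'n \<Rightarrow> (real^'n) \<times> real) \<Rightarrow> (real^'n \<Rightarrow> real) \<Rightarrow> real^'n \<Rightarrow> real"
where
  "jacobi_operator \<eta> m X \<nu> u x =
     laplace_beltrami X u x +
     (second_form_norm_sq X \<nu> x - m * \<eta> * height_power (snd (X x)) (m - 1) * snd (\<nu> x)) * u x"

definition second_variation ::
  "real \<Rightarrow> real \<Rightarrow> (real^'n::finite) set \<Rightarrow> (real^'n \<Rightarrow> (real^'n) \<times> real)
    \<Rightarrow> (real^'n \<Rightarrow> (real^'n) \<times> real) \<Rightarrow> (real^'n \<Rightarrow> real) \<Rightarrow> real"
where
  "second_variation \<eta> m D X \<nu> u =
     - (LINT x:D|lborel. u x * jacobi_operator \<eta> m X \<nu> u x * area_element X x)"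

definition stable ::
  "real \<Rightarrow> real \<Rightarrow> real \<Rightarrow> (real^'n::finite) set \<Rightarrow> (real^'n \<Rightarrow> (real^'n) \<times> real)
    \<Rightarrow> (real^'n \<Rightarrow> (real^'n) \<times> real) \<Rightarrow> bool"
where
  "stable \<eta> m lam D X \<nu> \<longleftrightarrow>
     stationary \<eta> m lam D X \<nu> \<and> (\<forall>u. test_function D u \<longrightarrow> second_variation \<eta> m D X \<nu> u \<ge> 0)"


section \<open>Compact graphs and their energy\<close>

text \<open>The graph over \<open>K\<close> has interior points over \<open>interior K\<close> and boundary over
  \<open>frontier K\<close>.  No regularity of \<open>frontier K\<close> is required.\<close>

definition compact_domain :: "(real^'n::finite) set \<Rightarrow> bool" where
  "compact_domain K \<longleftrightarrow> compact K \<and> K \<noteq> {} \<and> K = closure (interior K)"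

definition graph_param :: "(real^'n::finite \<Rightarrow> real) \<Rightarrow> real^'n \<Rightarrow> (real^'n) \<times> real" where
  "graph_param f x = (x, f x)"

text \<open>The orientation \<open>\<sigma>\<close> is \<open>1\<close> (upward normal) or \<open>-1\<close> (downward normal).\<close>

definition graph_normal ::
  "real \<Rightarrow> (real^'n::finite \<Rightarrow> real) \<Rightarrow> real^'n \<Rightarrow> (real^'n) \<times> real" where
  "graph_normal \<sigma> f x =
     (let Df = (\<chi> i. pd i f x) in (\<sigma> / sqrt (1 + (norm Df)\<^sup>2)) *\<^sub>R (- Df, 1))"

text \<open>
  The integral of a density \<open>w\<close> over the domain between the graph of \<open>f\<close> and the
  hyperplane at height \<open>0\<close>.  A part of this domain counts positively if the unit normal points
  out of it and negatively if the unit normal points into it.  This is the sign with which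
  \<open>- \<integral> (n H - (\<eta> x\<^sub>n\<^sub>+\<^sub>1\<^sup>m + lam)) u dA\<close> is the first variation of the energy; for an upward normal
  and a positive \<open>f\<close> it is the plain integral.
\<close>

definition enclosed_integral ::
  "real \<Rightarrow> (real^'n::finite) set \<Rightarrow> (real^'n \<Rightarrow> real) \<Rightarrow> ((real^'n) \<times> real \<Rightarrow> real) \<Rightarrow> real"
where
  "enclosed_integral \<sigma> D f w =
     \<sigma> * ((LINT p:{p. fst p \<in> D \<and> 0 < snd p \<and> snd p < f (fst p)}|lborel. w p)
        - (LINT p:{p. fst p \<in> D \<and> f (fst p) < snd p \<and> snd p < 0}|lborel. w p))"

definition energy ::
  "real \<Rightarrow> real \<Rightarrow> real \<Rightarrow> real \<Rightarrow> (real^'n::finite) set \<Rightarrow> (real^'n \<Rightarrow> real) \<Rightarrow> real"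
where
  "energy \<eta> m lam \<sigma> D f =
     (LINT x:D|lborel. area_element (graph_param f) x)
     + \<eta> * enclosed_integral \<sigma> D f (\<lambda>p. height_power (snd p) m)
     + lam * enclosed_integral \<sigma> D f (\<lambda>_. 1)"

text \<open>
  Heights at which the potential \<open>t\<^sup>m\<close> is considered.  For \<open>m \<notin> \<nat>\<close> hypersurfaces lie in the
  open upper half-space.  For even \<open>m\<close> they lie in the closed one: below height \<open>0\<close>
  the potential \<open>t\<^sup>m\<close> is decreasing, and there large horizontal discs (with
  \<open>lam = - \<eta> t\<^sup>m\<close>, \<open>\<eta> > 0\<close> and upward normal) are unstable, while the energy is unbounded from
  below.  For odd \<open>m\<close> there is no restriction.
\<close>

definition admissible_height :: "real \<Rightarrow> real \<Rightarrow> bool" where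
  "admissible_height m t \<longleftrightarrow>
     (m \<notin> \<nat> \<longrightarrow> 0 < t) \<and> (\<forall>k::nat. m = real k \<and> even k \<longrightarrow> 0 \<le> t)"

text \<open>
  Graphs of finite area with the same boundary as the graph of \<open>f\<close> over \<open>K\<close>.  They
  may become vertical at the boundary.
\<close>

definition graphs_with_boundary ::
  "real \<Rightarrow> (real^'n::finite) set \<Rightarrow> (real^'n \<Rightarrow> real) \<Rightarrow> (real^'n \<Rightarrow> real) set"
where
  "graphs_with_boundary m K f =
     {g. continuous_on K g \<and> Ck_on 1 (interior K) g
       \<and> set_integrable lborel (interior K) (area_element (graph_param g))
       \<and> (\<forall>x\<in>K. admissible_height m (g x))
       \<and> (\<forall>x\<in>frontier K. g x = f x)}"

end

theory Submission
  imports Defs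
begin

text \<open>
  Write \<open>p = Df\<close>, \<open>W = sqrt (1 + \<bar>p\<bar>\<^sup>2)\<close> and \<open>X = p / W\<close>.  The upward unit normal of the graph is
  \<open>(- X, 1 / W)\<close>, the mean curvature satisfies \<open>n H = \<sigma> Div X\<close>, and \<open>\<eta> \<nu>\<^sub>n\<^sub>+\<^sub>1 > 0\<close> means
  \<open>\<eta> \<sigma> > 0\<close>.  Stationarity is thus the equation \<open>Div X = \<sigma> (\<eta> f\<^sup>m + lam)\<close> on the base.

  Minimality holds because, as a functional of the height function, the energy is convex.  The area
  density satisfies \<open>W(g) \<ge> W(f) + X \<bullet> (Dg - Df)\<close>.  The potential energy per unit of base area has
  derivative \<open>\<sigma> (\<eta> t\<^sup>m + lam)\<close> in the height, which increases with \<open>t\<close> at admissible heights as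
  \<open>\<eta> \<sigma> > 0\<close>.  So the difference of the energies of \<open>g\<close> and \<open>f\<close> is at least
  \<open>\<integral> X \<bullet> (Dg - Df) + Div X (g - f) = \<integral> Div ((g - f) X)\<close>, which is zero, since \<open>g - f\<close>
  vanishes on the boundary.  The base may have a wild frontier and \<open>Dg\<close> need not extend to it, so the
  last step is proved on lines parallel to the axes, where the fundamental theorem of
  calculus applies to each interval of the base (\<open>integral_pd_zero\<close>).

  Stability is the infinitesimal form of the same convexity, but it is phrased with normal variations
  and the Laplacian of the hypersurface.  The two descriptions are linked by the field
  \<open>Y = (X \<bullet> grad) X\<close>.  On the one hand \<open>Div Y = \<bar>A\<bar>\<^sup>2 + X \<bullet> grad (Div X)\<close>, because \<open>\<bar>A\<bar>\<^sup>2\<close> is the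
  trace of the square of the Jacobian matrix of \<open>X\<close>; on the other hand \<open>Y\<close> is the gradient of \<open>W\<close> with
  its index raised, divided by \<open>W\<close>.  Hence \<open>- u (\<Delta>u + \<bar>A\<bar>\<^sup>2 u) W\<close> is, up to a divergence, the squared
  length of \<open>D(u W) / W\<close> in the metric of the graph, times \<open>W\<close>, plus \<open>u\<^sup>2 W X \<bullet> grad (Div X)\<close>
  (\<open>jacobi_operator_identity\<close>).  By stationarity, \<open>grad (Div X) = \<sigma> \<eta> m f\<^sup>m\<^sup>-\<^sup>1 p\<close>, so the last term
  is nonnegative, as is the contribution of the potential to the Jacobi operator.
\<close>

section \<open>Calculus of partial derivatives\<close>

lemma pd_eqI: "(F has_derivative F') (at x) \<Longrightarrow> pd i F x = F' (axis i 1)"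
  unfolding pd_def by (simp add: frechet_derivative_at[symmetric])

lemma has_derivative_pd:
  assumes "F differentiable (at x)"
  shows "(F has_derivative frechet_derivative F (at x)) (at x)"
  using assms frechet_derivative_works by blast

lemma pd_cong_open:
  assumes "open S" "x \<in> S" "\<And>y. y \<in> S \<Longrightarrow> F y = G y"
  shows "pd i F x = pd i G x"
proof -
  have "(F has_derivative F') (at x) \<longleftrightarrow> (G has_derivative F') (at x)" for F'
    using assms has_derivative_transform_within_open[of F F' x UNIV S G]
      has_derivative_transform_within_open[of G F' x UNIV S F] by auto
  then show ?thesis
    by (simp add: pd_def frechet_derivative_def)
qed

lemma differentiable_cong_open:
  assumes "open S" "x \<in> S" "\<And>y. y \<in> S \<Longrightarrow> F y = G y" "F differentiable (at x)"
  shows "G differentiable (at x)"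
  using assms has_derivative_transform_within_open[of F _ x UNIV S G]
  unfolding differentiable_def by blast

lemma pd_const [simp]: "pd i (\<lambda>_. c) x = 0"
  by (rule pd_eqI[where F'="\<lambda>_. 0", simplified]) simp

lemma pd_add:
  assumes "F differentiable (at x)" "G differentiable (at x)"
  shows "pd i (\<lambda>y. F y + G y) x = pd i F x + pd i G x"
  using pd_eqI[OF has_derivative_add[OF assms[THEN has_derivative_pd]]] by (simp add: pd_def)

lemma pd_diff:
  assumes "F differentiable (at x)" "G differentiable (at x)"
  shows "pd i (\<lambda>y. F y - G y) x = pd i F x - pd i G x"
  using pd_eqI[OF has_derivative_diff[OF assms[THEN has_derivative_pd]]] by (simp add: pd_def)

lemma pd_sum:
  assumes "\<And>k. k \<in> I \<Longrightarrow> F k differentiable (at x)"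
  shows "pd i (\<lambda>y. \<Sum>k\<in>I. F k y) x = (\<Sum>k\<in>I. pd i (F k) x)"
  using pd_eqI[OF has_derivative_sum[of I F "\<lambda>k. frechet_derivative (F k) (at x)" "at x"]]
    assms[THEN has_derivative_pd] by (simp add: pd_def)

lemma pd_mult:
  fixes F G :: "real^'n::finite \<Rightarrow> real"
  assumes "F differentiable (at x)" "G differentiable (at x)"
  shows "pd i (\<lambda>y. F y * G y) x = F x * pd i G x + pd i F x * G x"
  using pd_eqI[OF has_derivative_mult[OF assms[THEN has_derivative_pd]]] by (simp add: pd_def)

lemma pd_comp_real:
  fixes F :: "real^'n::finite \<Rightarrow> real"
  assumes "F differentiable (at x)" "(h has_real_derivative h') (at (F x))"
  shows "pd i (\<lambda>y. h (F y)) x = h' * pd i F x"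
    and "(\<lambda>y. h (F y)) differentiable (at x)"
proof -
  have d: "((\<lambda>y. h (F y)) has_derivative (\<lambda>v. h' * frechet_derivative F (at x) v)) (at x)"
    using has_derivative_compose[OF has_derivative_pd[OF assms(1)]
      assms(2)[unfolded has_field_derivative_def]] by simp
  then show "pd i (\<lambda>y. h (F y)) x = h' * pd i F x"
    using pd_eqI by (fastforce simp: pd_def)
  show "(\<lambda>y. h (F y)) differentiable (at x)"
    using d unfolding differentiable_def by blast
qed

lemma pd_inverse:
  fixes F :: "real^'n::finite \<Rightarrow> real"
  assumes "F differentiable (at x)" "F x \<noteq> 0"
  shows "pd i (\<lambda>y. inverse (F y)) x = - (inverse (F x) * inverse (F x)) * pd i F x"
    and "(\<lambda>y. inverse (F y)) differentiable (at x)"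
proof -
  have h: "(inverse has_real_derivative - (inverse (F x) * inverse (F x))) (at (F x))"
    using DERIV_inverse'[OF DERIV_ident assms(2)] by simp
  show "pd i (\<lambda>y. inverse (F y)) x = - (inverse (F x) * inverse (F x)) * pd i F x"
    by (rule pd_comp_real(1)[OF assms(1) h])
  show "(\<lambda>y. inverse (F y)) differentiable (at x)"
    by (rule pd_comp_real(2)[OF assms(1) h])
qed

lemma pd_sqrt:
  fixes F :: "real^'n::finite \<Rightarrow> real"
  assumes "F differentiable (at x)" "F x > 0"
  shows "pd i (\<lambda>y. sqrt (F y)) x = inverse (2 * sqrt (F x)) * pd i F x"
    and "(\<lambda>y. sqrt (F y)) differentiable (at x)"
proof -
  have h: "(sqrt has_real_derivative inverse (2 * sqrt (F x))) (at (F x))"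
    using DERIV_real_sqrt[OF assms(2)] by (simp add: field_simps)
  show "pd i (\<lambda>y. sqrt (F y)) x = inverse (2 * sqrt (F x)) * pd i F x"
    by (rule pd_comp_real(1)[OF assms(1) h])
  show "(\<lambda>y. sqrt (F y)) differentiable (at x)"
    by (rule pd_comp_real(2)[OF assms(1) h])
qed

section \<open>Functions of class C^k and smooth functions\<close>

lemma Ck_on_subset: "Ck_on k S F \<Longrightarrow> T \<subseteq> S \<Longrightarrow> Ck_on k T F"
  by (induction k arbitrary: F) (auto intro: continuous_on_subset)

lemma Ck_on_SucD: "Ck_on (Suc k) S F \<Longrightarrow> Ck_on k S F"
proof (induction k arbitrary: F)
  case 0
  then show ?case
    by (auto intro!: continuous_at_imp_continuous_on differentiable_imp_continuous_within)
qed auto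

lemma Ck_on_cong:
  assumes "open S" "\<And>y. y \<in> S \<Longrightarrow> F y = G y" "Ck_on k S F"
  shows "Ck_on k S G"
  using assms(2,3)
proof (induction k arbitrary: F G)
  case 0
  then show ?case using continuous_on_cong[of S S F G] by simp
next
  case (Suc k)
  have "Ck_on k S (pd i G)" for i
    using Suc.IH[of "pd i F" "pd i G"] Suc.prems pd_cong_open[OF assms(1)] by (metis Ck_on.simps(2))
  moreover have "G differentiable (at x)" if "x \<in> S" for x
    using differentiable_cong_open[OF assms(1) that] Suc.prems that by (metis Ck_on.simps(2))
  ultimately show ?case by simp
qed

lemma Ck_on_const: "Ck_on k S (\<lambda>_. c)"
proof (induction k arbitrary: c)
  case (Suc k)
  have "pd i (\<lambda>_. c) = (\<lambda>_. 0)" for i :: 'a by (simp add: fun_eq_iff)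
  then show ?case using Suc by simp
qed simp

lemma Ck_on_add:
  assumes "open S" "Ck_on k S F" "Ck_on k S G"
  shows "Ck_on k S (\<lambda>y. F y + G y)"
  using assms(2,3)
proof (induction k arbitrary: F G)
  case (Suc k)
  have "Ck_on k S (pd i (\<lambda>y. F y + G y))" for i
    by (rule Ck_on_cong[OF assms(1) _ Suc.IH[of "pd i F" "pd i G"]])
      (use Suc.prems in \<open>auto simp: pd_add\<close>)
  then show ?case using Suc.prems by (auto intro: differentiable_add)
qed (auto intro: continuous_on_add)

lemma Ck_on_mult:
  assumes "open S" "Ck_on k S F" "Ck_on k S G"
  shows "Ck_on k S (\<lambda>y. F y * G y)"
  using assms(2,3)
proof (induction k arbitrary: F G)
  case (Suc k)
  have "Ck_on k S (pd i (\<lambda>y. F y * G y))" for i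
  proof (rule Ck_on_cong[OF assms(1)])
    show "Ck_on k S (\<lambda>y. F y * pd i G y + pd i F y * G y)"
      using Suc.prems Ck_on_SucD[OF Suc.prems(1)] Ck_on_SucD[OF Suc.prems(2)]
      by (intro Ck_on_add[OF assms(1)] Suc.IH) auto
  qed (use Suc.prems in \<open>auto simp: pd_mult\<close>)
  then show ?case using Suc.prems by (auto intro: differentiable_mult)
qed (auto intro: continuous_on_mult)

lemma Ck_on_inverse:
  assumes "open S" "Ck_on k S F" "\<And>y. y \<in> S \<Longrightarrow> F y \<noteq> 0"
  shows "Ck_on k S (\<lambda>y. inverse (F y))"
  using assms(2)
proof (induction k)
  case (Suc k)
  have "Ck_on k S (pd i (\<lambda>y. inverse (F y)))" for i
  proof (rule Ck_on_cong[OF assms(1)])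
    show "Ck_on k S (\<lambda>y. (- 1) * (inverse (F y) * inverse (F y)) * pd i F y)"
      using Suc.prems Suc.IH Ck_on_SucD[OF Suc.prems]
      by (intro Ck_on_mult[OF assms(1)] Ck_on_const) auto
  qed (use Suc.prems assms(3) in \<open>auto simp: pd_inverse\<close>)
  then show ?case using Suc.prems assms(3) by (auto intro: pd_inverse)
qed (auto intro!: continuous_on_inverse assms(3))

lemma Ck_on_sqrt:
  assumes "open S" "Ck_on k S F" "\<And>y. y \<in> S \<Longrightarrow> F y > 0"
  shows "Ck_on k S (\<lambda>y. sqrt (F y))"
  using assms(2)
proof (induction k)
  case (Suc k)
  have "Ck_on k S (pd i (\<lambda>y. sqrt (F y)))" for i
  proof (rule Ck_on_cong[OF assms(1)])
    show "Ck_on k S (\<lambda>y. inverse (2 * sqrt (F y)) * pd i F y)"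
      using Suc.prems Suc.IH Ck_on_SucD[OF Suc.prems] assms(3)
      by (intro Ck_on_mult[OF assms(1)] Ck_on_inverse[OF assms(1)] Ck_on_const) force+
  qed (use Suc.prems assms(3) in \<open>auto simp: pd_sqrt\<close>)
  then show ?case using Suc.prems assms(3) by (auto intro: pd_sqrt)
qed (auto intro!: continuous_on_real_sqrt)

lemma smooth_on_differentiable: "smooth_on S F \<Longrightarrow> x \<in> S \<Longrightarrow> F differentiable (at x)"
  unfolding smooth_on_def by (metis Ck_on.simps(2))

lemma smooth_on_pd: "smooth_on S F \<Longrightarrow> smooth_on S (pd i F)"
  unfolding smooth_on_def by (metis Ck_on.simps(2))

lemma smooth_on_continuous: "smooth_on S F \<Longrightarrow> continuous_on S F"
  unfolding smooth_on_def by (metis Ck_on.simps(1))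

lemma smooth_on_subset: "smooth_on S F \<Longrightarrow> T \<subseteq> S \<Longrightarrow> smooth_on T F"
  unfolding smooth_on_def by (blast intro: Ck_on_subset)

lemma smooth_on_const: "smooth_on S (\<lambda>_. c)"
  unfolding smooth_on_def by (simp add: Ck_on_const)

lemma smooth_on_add: "open S \<Longrightarrow> smooth_on S F \<Longrightarrow> smooth_on S G \<Longrightarrow> smooth_on S (\<lambda>y. F y + G y)"
  unfolding smooth_on_def by (simp add: Ck_on_add)

lemma smooth_on_mult: "open S \<Longrightarrow> smooth_on S F \<Longrightarrow> smooth_on S G \<Longrightarrow> smooth_on S (\<lambda>y. F y * G y)"
  unfolding smooth_on_def by (simp add: Ck_on_mult)

lemma smooth_on_inverse:
  "open S \<Longrightarrow> smooth_on S F \<Longrightarrow> (\<And>y. y \<in> S \<Longrightarrow> F y \<noteq> 0) \<Longrightarrow> smooth_on S (\<lambda>y. inverse (F y))"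
  unfolding smooth_on_def by (simp add: Ck_on_inverse)

lemma smooth_on_divide:
  "open S \<Longrightarrow> smooth_on S F \<Longrightarrow> smooth_on S G \<Longrightarrow> (\<And>y. y \<in> S \<Longrightarrow> G y \<noteq> 0)
    \<Longrightarrow> smooth_on S (\<lambda>y. F y / G y)"
  unfolding divide_inverse by (intro smooth_on_mult smooth_on_inverse)

lemma smooth_on_sqrt:
  "open S \<Longrightarrow> smooth_on S F \<Longrightarrow> (\<And>y. y \<in> S \<Longrightarrow> F y > 0) \<Longrightarrow> smooth_on S (\<lambda>y. sqrt (F y))"
  unfolding smooth_on_def by (simp add: Ck_on_sqrt)

lemma smooth_on_sum:
  "open S \<Longrightarrow> (\<And>k. k \<in> I \<Longrightarrow> smooth_on S (F k)) \<Longrightarrow> smooth_on S (\<lambda>y. \<Sum>k\<in>I. F k y)"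
  by (induction I rule: infinite_finite_induct) (auto intro: smooth_on_const smooth_on_add)

section \<open>Symmetry of second partial derivatives\<close>

lemma line_has_real_derivative:
  fixes F :: "real^'n::finite \<Rightarrow> real"
  assumes "F differentiable (at (x + t *\<^sub>R axis i 1))"
  shows "((\<lambda>s. F (x + s *\<^sub>R axis i 1)) has_real_derivative pd i F (x + t *\<^sub>R axis i 1)) (at t)"
proof -
  let ?L = "frechet_derivative F (at (x + t *\<^sub>R axis i 1))"
  have L: "(F has_derivative ?L) (at (x + t *\<^sub>R axis i 1))"
    by (rule has_derivative_pd[OF assms])
  have "((\<lambda>s. x + s *\<^sub>R axis i 1) has_derivative (\<lambda>s. s *\<^sub>R axis i 1)) (at t)"
    by (auto intro!: derivative_eq_intros)
  from has_derivative_compose[OF this L]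
  have "((\<lambda>s. F (x + s *\<^sub>R axis i 1)) has_derivative (\<lambda>s. ?L (s *\<^sub>R axis i 1))) (at t)" .
  moreover have "(\<lambda>s. ?L (s *\<^sub>R axis i 1)) = (*) (pd i F (x + t *\<^sub>R axis i 1))"
    using linear_scale[OF has_derivative_linear[OF L]] by (auto simp: pd_def)
  ultimately show ?thesis by (simp add: has_field_derivative_def)
qed

text \<open>The mean value theorem is applied once in each direction.  As the second difference on the
  left-hand side is symmetric in \<open>i\<close> and \<open>j\<close>, it is close to both mixed derivatives for small
  \<open>h\<close>, up to the factor \<open>h * h\<close>.\<close>

lemma second_difference_mean_value:
  fixes F :: "real^'n::finite \<Rightarrow> real"
  assumes h: "h > 0"
    and F: "\<And>s t. 0 \<le> s \<Longrightarrow> s \<le> h \<Longrightarrow> 0 \<le> t \<Longrightarrow> t \<le> h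
      \<Longrightarrow> F differentiable (at (x + s *\<^sub>R axis i 1 + t *\<^sub>R axis j 1))"
    and DF: "\<And>s t. 0 \<le> s \<Longrightarrow> s \<le> h \<Longrightarrow> 0 \<le> t \<Longrightarrow> t \<le> h
      \<Longrightarrow> pd i F differentiable (at (x + s *\<^sub>R axis i 1 + t *\<^sub>R axis j 1))"
  obtains s t where "0 < s" "s < h" "0 < t" "t < h"
    "F (x + h *\<^sub>R axis i 1 + h *\<^sub>R axis j 1) - F (x + h *\<^sub>R axis i 1)
       - F (x + h *\<^sub>R axis j 1) + F x
      = h * h * pd j (pd i F) (x + s *\<^sub>R axis i 1 + t *\<^sub>R axis j 1)"
proof -
  define G where "G s = F ((x + h *\<^sub>R axis j 1) + s *\<^sub>R axis i 1) - F (x + s *\<^sub>R axis i 1)" for s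
  have G': "(G has_real_derivative pd i F ((x + h *\<^sub>R axis j 1) + s *\<^sub>R axis i 1)
      - pd i F (x + s *\<^sub>R axis i 1)) (at s)" if "0 \<le> s" "s \<le> h" for s
    unfolding G_def
    using F[of s h] F[of s 0] that h
    by (intro DERIV_diff line_has_real_derivative) (simp_all add: algebra_simps)
  obtain s where s: "0 < s" "s < h" "G h - G 0 = (h - 0) *
      (pd i F ((x + h *\<^sub>R axis j 1) + s *\<^sub>R axis i 1) - pd i F (x + s *\<^sub>R axis i 1))"
    using MVT2[of 0 h G "\<lambda>s. pd i F ((x + h *\<^sub>R axis j 1) + s *\<^sub>R axis i 1)
      - pd i F (x + s *\<^sub>R axis i 1)"] h G' by blast
  define H where "H t = pd i F ((x + s *\<^sub>R axis i 1) + t *\<^sub>R axis j 1)" for t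
  have H': "(H has_real_derivative pd j (pd i F) ((x + s *\<^sub>R axis i 1) + t *\<^sub>R axis j 1)) (at t)"
    if "0 \<le> t" "t \<le> h" for t
    unfolding H_def using DF[of s t] that s by (intro line_has_real_derivative) simp_all
  obtain t where t: "0 < t" "t < h"
    "H h - H 0 = (h - 0) * pd j (pd i F) ((x + s *\<^sub>R axis i 1) + t *\<^sub>R axis j 1)"
    using MVT2[of 0 h H "\<lambda>t. pd j (pd i F) ((x + s *\<^sub>R axis i 1) + t *\<^sub>R axis j 1)"] h H' by blast
  have "pd i F ((x + h *\<^sub>R axis j 1) + s *\<^sub>R axis i 1) - pd i F (x + s *\<^sub>R axis i 1) = H h - H 0"
    by (simp add: H_def algebra_simps)
  then have "G h - G 0 = h * h * pd j (pd i F) (x + s *\<^sub>R axis i 1 + t *\<^sub>R axis j 1)"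
    using s t by simp
  then show ?thesis
    using that[of s t] s t by (simp add: G_def algebra_simps)
qed

lemma pd_commute:
  fixes F :: "real^'n::finite \<Rightarrow> real"
  assumes "open S" "x \<in> S" "Ck_on 2 S F"
  shows "pd i (pd j F) x = pd j (pd i F) x"
proof (rule ccontr)
  assume ne: "pd i (pd j F) x \<noteq> pd j (pd i F) x"
  let ?e = "\<bar>pd i (pd j F) x - pd j (pd i F) x\<bar> / 2"
  have e: "?e > 0" using ne by simp
  have C: "\<And>y. y \<in> S \<Longrightarrow> F differentiable (at y)" "\<And>k y. y \<in> S \<Longrightarrow> pd k F differentiable (at y)"
    "\<And>k l. continuous_on S (pd k (pd l F))"
    using assms(3) by (simp_all add: numeral_2_eq_2)
  have cont: "isCont (pd k (pd l F)) x" for k l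
    using C(3)[of k l] assms(1,2) continuous_on_eq_continuous_at by blast
  obtain d1 where d1: "d1 > 0" "\<And>y. dist y x < d1 \<Longrightarrow> dist (pd i (pd j F) y) (pd i (pd j F) x) < ?e"
    using cont[of i j] e unfolding continuous_at_eps_delta by blast
  obtain d2 where d2: "d2 > 0" "\<And>y. dist y x < d2 \<Longrightarrow> dist (pd j (pd i F) y) (pd j (pd i F) x) < ?e"
    using cont[of j i] e unfolding continuous_at_eps_delta by blast
  obtain d3 where d3: "d3 > 0" "ball x d3 \<subseteq> S"
    using assms(1,2) open_contains_ball by blast
  define h where "h = min d1 (min d2 d3) / 3"
  have h: "h > 0" "2 * h < d1" "2 * h < d2" "2 * h < d3"
    using d1 d2 d3 by (auto simp: h_def)
  have near: "dist (x + s *\<^sub>R axis k 1 + t *\<^sub>R axis l 1) x \<le> 2 * h"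
    if "0 \<le> s" "s \<le> h" "0 \<le> t" "t \<le> h" for s t and k l :: 'n
  proof -
    have "norm (s *\<^sub>R axis k (1::real) + t *\<^sub>R axis l 1) \<le> \<bar>s\<bar> * 1 + \<bar>t\<bar> * 1"
      by (rule order_trans[OF norm_triangle_ineq]) simp
    then show ?thesis using that by (simp add: dist_norm algebra_simps)
  qed
  have inS: "x + s *\<^sub>R axis k 1 + t *\<^sub>R axis l 1 \<in> S"
    if "0 \<le> s" "s \<le> h" "0 \<le> t" "t \<le> h" for s t k l
    using near[OF that, of k l] h(4) d3(2) by (force simp: dist_commute)
  obtain s t where st: "0 < s" "s < h" "0 < t" "t < h"
    "F (x + h *\<^sub>R axis i 1 + h *\<^sub>R axis j 1) - F (x + h *\<^sub>R axis i 1)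
       - F (x + h *\<^sub>R axis j 1) + F x
      = h * h * pd j (pd i F) (x + s *\<^sub>R axis i 1 + t *\<^sub>R axis j 1)"
    using second_difference_mean_value[OF h(1), of F x i j] inS C(1,2) by blast
  obtain s' t' where st': "0 < s'" "s' < h" "0 < t'" "t' < h"
    "F (x + h *\<^sub>R axis j 1 + h *\<^sub>R axis i 1) - F (x + h *\<^sub>R axis j 1)
       - F (x + h *\<^sub>R axis i 1) + F x
      = h * h * pd i (pd j F) (x + s' *\<^sub>R axis j 1 + t' *\<^sub>R axis i 1)"
    using second_difference_mean_value[OF h(1), of F x j i] inS C(1,2) by blast
  have "h * h * pd i (pd j F) (x + s' *\<^sub>R axis j 1 + t' *\<^sub>R axis i 1)
      = h * h * pd j (pd i F) (x + s *\<^sub>R axis i 1 + t *\<^sub>R axis j 1)"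
  proof -
    have swap: "x + h *\<^sub>R axis j 1 + h *\<^sub>R axis i 1 = x + h *\<^sub>R axis i 1 + h *\<^sub>R axis j 1"
      by (simp add: add_ac)
    show ?thesis using st(5) st'(5)[unfolded swap] by linarith
  qed
  then have "pd i (pd j F) (x + s' *\<^sub>R axis j 1 + t' *\<^sub>R axis i 1)
      = pd j (pd i F) (x + s *\<^sub>R axis i 1 + t *\<^sub>R axis j 1)"
    using h(1) by simp
  moreover have "dist (pd i (pd j F) (x + s' *\<^sub>R axis j 1 + t' *\<^sub>R axis i 1)) (pd i (pd j F) x) < ?e"
    using d1(2) near[of s' t' j i] st' h by auto
  moreover have "dist (pd j (pd i F) (x + s *\<^sub>R axis i 1 + t *\<^sub>R axis j 1)) (pd j (pd i F) x) < ?e"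
    using d2(2) near[of s t i j] st h by auto
  ultimately show False
    unfolding dist_real_def by (smt (verit) field_sum_of_halves)
qed

section \<open>Integrals of derivatives of functions vanishing on the boundary\<close>

lemma bounded_open_connected_real:
  fixes C :: "real set"
  assumes "open C" "connected C" "bounded C" "C \<noteq> {}"
  obtains a b where "a < b" "C = {a<..<b}"
proof -
  have bdd: "bdd_above C" "bdd_below C"
    using assms(3) bounded_imp_bdd_above bounded_imp_bdd_below by auto
  have sub: "C \<subseteq> {Inf C<..<Sup C}"
  proof
    fix x assume x: "x \<in> C"
    obtain e where e: "e > 0" "ball x e \<subseteq> C" using assms(1) x open_contains_ball by blast
    then have "x - e/2 \<in> C" "x + e/2 \<in> C" by (auto simp: subset_iff dist_real_def)
    then show "x \<in> {Inf C<..<Sup C}"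
      using cInf_lower[OF _ bdd(2)] cSup_upper[OF _ bdd(1)] e(1) by fastforce
  qed
  have sup: "{Inf C<..<Sup C} \<subseteq> C"
  proof
    fix x assume x: "x \<in> {Inf C<..<Sup C}"
    obtain c d where "c \<in> C" "c < x" "d \<in> C" "x < d"
      using cInf_lessD[OF assms(4), of x] less_cSupD[OF assms(4), of x] x by auto
    then show "x \<in> C"
      using assms(2) unfolding connected_iff_interval by (meson less_imp_le)
  qed
  have "Inf C < Sup C" using sub assms(4) by fastforce
  then show ?thesis using that sub sup by blast
qed

lemma integral_derivative_interval_zero:
  fixes \<psi> \<psi>' :: "real \<Rightarrow> real"
  assumes "a < b" "continuous_on {a..b} \<psi>" "\<psi> a = 0" "\<psi> b = 0"
    and d: "\<And>t. a < t \<Longrightarrow> t < b \<Longrightarrow> (\<psi> has_real_derivative \<psi>' t) (at t)"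
    and c: "continuous_on {a<..<b} \<psi>'" and i: "set_integrable lborel {a<..<b} \<psi>'"
  shows "(LINT t:{a<..<b}|lborel. \<psi>' t) = 0"
proof -
  have "(LBINT t=ereal a..ereal b. \<psi>' t) = 0 - 0"
  proof (rule interval_integral_FTC_integrable[where F=\<psi>])
    show "((\<psi> \<circ> real_of_ereal) \<longlongrightarrow> 0) (at_right (ereal a))"
      using continuous_on_Icc_at_rightD[OF assms(2,1)] assms(3) by (simp add: ereal_tendsto_simps)
    show "((\<psi> \<circ> real_of_ereal) \<longlongrightarrow> 0) (at_left (ereal b))"
      using continuous_on_Icc_at_leftD[OF assms(2,1)] assms(4) by (simp add: ereal_tendsto_simps)
    show "isCont \<psi>' x" if "ereal a < ereal x" "ereal x < ereal b" for x
      using c that continuous_on_eq_continuous_at[of "{a<..<b}" \<psi>'] by auto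
  qed (use assms(1) d i in \<open>auto simp: has_real_derivative_iff_has_vector_derivative\<close>)
  then show ?thesis
    using assms(1) by (simp add: interval_lebesgue_integral_def)
qed

text \<open>On the line, an open set is a countable disjoint union of intervals whose end points
  lie on its frontier; the fundamental theorem of calculus gives zero on each of them.\<close>

lemma integral_derivative_open_zero:
  fixes \<psi> \<psi>' :: "real \<Rightarrow> real"
  assumes S: "open S" "bounded S"
    and cont: "continuous_on (closure S) \<psi>" and bd: "\<And>t. t \<in> frontier S \<Longrightarrow> \<psi> t = 0"
    and d: "\<And>t. t \<in> S \<Longrightarrow> (\<psi> has_real_derivative \<psi>' t) (at t)"
    and c: "continuous_on S \<psi>'" and i: "set_integrable lborel S \<psi>'"
  shows "(LINT t:S|lborel. \<psi>' t) = 0"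
proof -
  have comp: "open C \<and> C \<subseteq> S \<and> (LINT t:C|lborel. \<psi>' t) = 0" if C: "C \<in> components S" for C
  proof -
    have op: "open C" and sub: "C \<subseteq> S"
      using C S(1) open_components in_components_subset by blast+
    obtain a b where ab: "a < b" "C = {a<..<b}"
      using bounded_open_connected_real[OF op in_components_connected[OF C]]
        bounded_subset[OF S(2) sub] in_components_nonempty[OF C] by metis
    have clC: "closure C = {a..b}" using ab by simp
    have "frontier C = {a, b}"
      using ab clC by (auto simp: frontier_def)
    then have "a \<in> frontier S" "b \<in> frontier S"
      using frontier_of_components_subset[OF C] by auto
    moreover have "continuous_on {a..b} \<psi>"
      using continuous_on_subset[OF cont closure_mono[OF sub]] clC by simp
    ultimately have "(LINT t:C|lborel. \<psi>' t) = 0"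
      unfolding ab(2) using ab sub bd d
      by (intro integral_derivative_interval_zero[of a b \<psi>])
        (auto intro: continuous_on_subset[OF c] set_integrable_subset[OF i])
    then show ?thesis using op sub by simp
  qed
  have "countable (components S)"
    using countable_disjoint_open_subsets[of "components S"] comp pairwise_disjoint_components[of S]
    by (auto simp: pairwise_def disjnt_def disjoint_def)
  then have inj: "inj_on (to_nat_on (components S)) (components S)" by (rule inj_on_to_nat_on)
  \<comment> \<open>The components are enumerated by \<open>\<nat>\<close>, with the empty set at unused indices.\<close>
  define A where "A n = \<Union>{C \<in> components S. to_nat_on (components S) C = n}" for n
  have A: "A n = {} \<or> A n \<in> components S" for n
  proof -
    have "{C \<in> components S. to_nat_on (components S) C = n} = {}
        \<or> (\<exists>C\<in>components S. {C \<in> components S. to_nat_on (components S) C = n} = {C})"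
      using inj unfolding inj_on_def by blast
    then show ?thesis unfolding A_def by auto
  qed
  have un: "(\<Union>n. A n) = S"
  proof -
    have "(\<Union>n. A n) = \<Union>(components S)" unfolding A_def by blast
    then show ?thesis by (metis Union_components)
  qed
  have disj: "A m \<inter> A n = {}" if "m \<noteq> n" for m n
    using that components_nonoverlap[of _ S] unfolding A_def by fastforce
  have meas: "A n \<in> sets lborel" for n
    using A[of n] comp[of "A n"] by auto
  have "(LINT t:A n|lborel. \<psi>' t) = 0" for n
    using A[of n] comp[of "A n"] by (auto simp: set_lebesgue_integral_def)
  then show ?thesis
    using lebesgue_integral_countable_add[of A lborel \<psi>', OF meas disj] i un by simp
qed

lemma lborel_translation:
  fixes F :: "'a::euclidean_space \<Rightarrow> real"
  assumes "F \<in> borel_measurable borel"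
  shows "integrable lborel (\<lambda>x. F (c + x)) \<longleftrightarrow> integrable lborel F"
    and "(LINT x|lborel. F (c + x)) = (LINT x|lborel. F x)"
proof -
  have "integrable (distr lborel borel ((+) c)) F \<longleftrightarrow> integrable lborel (\<lambda>x. F (c + x))"
    using assms by (intro integrable_distr_eq) auto
  then show "integrable lborel (\<lambda>x. F (c + x)) \<longleftrightarrow> integrable lborel F"
    by (simp add: lborel_distr_plus)
  have "integral\<^sup>L (distr lborel borel ((+) c)) F = (LINT x|lborel. F (c + x))"
    using assms by (intro integral_distr) auto
  then show "(LINT x|lborel. F (c + x)) = (LINT x|lborel. F x)"
    by (simp add: lborel_distr_plus)
qed

text \<open>Slicing by parallel lines.  Inserting the factor
  \<open>1 = \<integral> indicator {0..1} (x \<bullet> b - t) dt\<close> and translating by \<open>t *\<^sub>R b\<close> turns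
  \<open>\<integral> F\<close> into the integral, over the slab \<open>0 \<le> x \<bullet> b \<le> 1\<close>, of the line integrals of \<open>F\<close>.\<close>

lemma integral_zero_if_line_integrals_zero:
  fixes F :: "'a::euclidean_space \<Rightarrow> real"
  assumes F: "integrable lborel F" and b: "b \<in> Basis"
    and line: "\<And>x. (LINT t|lborel. F (x + t *\<^sub>R b)) = 0"
  shows "(LINT x|lborel. F x) = 0"
proof -
  have [measurable]: "F \<in> borel_measurable borel"
    using F by (auto dest: borel_measurable_integrable)
  let ?I = "indicator {0..1::real} :: real \<Rightarrow> real"
  define G where "G x t = F x * ?I (x \<bullet> b - t)" for x and t :: real
  define H where "H x t = F (x + t *\<^sub>R b) * ?I (x \<bullet> b)" for x and t :: real
  have [measurable]: "(\<lambda>(x, t). G x t) \<in> borel_measurable (lborel \<Otimes>\<^sub>M lborel)"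
    "(\<lambda>(t, x). G x t) \<in> borel_measurable (lborel \<Otimes>\<^sub>M lborel)"
    "(\<lambda>(x, t). H x t) \<in> borel_measurable (lborel \<Otimes>\<^sub>M lborel)"
    "(\<lambda>(t, x). H x t) \<in> borel_measurable (lborel \<Otimes>\<^sub>M lborel)"
    unfolding G_def H_def by measurable
  have slab: "?I (x \<bullet> b - t) = indicator {x \<bullet> b - 1..x \<bullet> b} t" for x t
    by (auto simp: indicator_def)
  have Ii: "integrable lborel (\<lambda>t. indicator {u - 1..u} t :: real)" "(LINT t|lborel. indicator {u - 1..u} t) = (1::real)" for u :: real
    by simp_all
  have Gi: "integrable lborel (\<lambda>t. G x t)" "(LINT t|lborel. G x t) = F x"
    "(LINT t|lborel. norm (G x t)) = norm (F x)" for x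
    unfolding G_def slab by (simp_all add: abs_mult Ii)
  have intG: "integrable (lborel \<Otimes>\<^sub>M lborel) (\<lambda>(x, t). G x t)"
    by (rule lborel_pair.Fubini_integrable) (use F in \<open>simp_all add: Gi[unfolded real_norm_def] Gi\<close>)
  have trans: "H x t = G (t *\<^sub>R b + x) t" for x t
    using b by (simp add: G_def H_def inner_add_left add.commute)
  have intG': "integrable (lborel \<Otimes>\<^sub>M lborel) (\<lambda>(t, x). G x t)"
    using lborel_pair.integrable_product_swap[OF intG] by simp
  have Gm: "(\<lambda>x. G x t) \<in> borel_measurable borel" "(\<lambda>x. norm (G x t)) \<in> borel_measurable borel" for t
    unfolding G_def by measurable
  have intH': "integrable (lborel \<Otimes>\<^sub>M lborel) (\<lambda>(t, x). H x t)"
  proof (rule lborel_pair.Fubini_integrable)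
    show "integrable lborel (\<lambda>t. LINT x|lborel. norm (case (t, x) of (t, x) \<Rightarrow> H x t))"
      using lborel_pair.integrable_fst'[OF integrable_norm[OF intG']]
      by (simp add: trans lborel_translation(2)[OF Gm(2), simplified] case_prod_unfold)
    show "AE t in lborel. integrable lborel (\<lambda>x. case (t, x) of (t, x) \<Rightarrow> H x t)"
      using lborel_pair.AE_integrable_fst'[OF intG']
      by (simp add: trans lborel_translation(1)[OF Gm(1)])
  qed simp
  have "(LINT x|lborel. F x) = (LINT x|lborel. LINT t|lborel. G x t)"
    by (simp add: Gi)
  also have "\<dots> = (LINT t|lborel. LINT x|lborel. G x t)"
    by (rule lborel_pair.Fubini_integral[OF intG, symmetric])
  also have "\<dots> = (LINT t|lborel. LINT x|lborel. H x t)"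
    by (simp add: trans lborel_translation(2)[OF Gm(1)])
  also have "\<dots> = (LINT x|lborel. LINT t|lborel. H x t)"
    by (rule lborel_pair.Fubini_integral[OF intH', symmetric])
  also have "\<dots> = 0"
    by (simp add: H_def line)
  finally show ?thesis .
qed

text \<open>However irregular the frontier, a line in the direction of the \<open>i\<close>-th axis meets \<open>D\<close> in an
  open subset of the line whose frontier points lie on the frontier of \<open>D\<close>, so that the
  one-dimensional case applies to it.\<close>

proposition integral_pd_zero:
  fixes D :: "(real^'n::finite) set" and \<psi> :: "real^'n \<Rightarrow> real"
  assumes D: "open D" "bounded D"
    and cont: "continuous_on (closure D) \<psi>" and bd: "\<And>x. x \<in> frontier D \<Longrightarrow> \<psi> x = 0"
    and d: "\<And>x. x \<in> D \<Longrightarrow> \<psi> differentiable (at x)"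
    and c: "continuous_on D (pd i \<psi>)" and i: "set_integrable lborel D (pd i \<psi>)"
  shows "(LINT x:D|lborel. pd i \<psi> x) = 0"
proof -
  let ?e = "axis i 1 :: real^'n"
  have e: "?e \<in> Basis" by (simp add: axis_in_Basis_iff)
  have "(LINT t|lborel. indicator D (x + t *\<^sub>R ?e) *\<^sub>R pd i \<psi> (x + t *\<^sub>R ?e)) = 0" for x
  proof -
    define l where "l t = x + t *\<^sub>R ?e" for t :: real
    define T where "T = l -` D"
    have l: "continuous_on S l" for S unfolding l_def by (intro continuous_intros)
    have T: "open T" unfolding T_def using D(1) l by (simp add: open_vimage)
    obtain B where B: "\<And>y. y \<in> D \<Longrightarrow> norm y \<le> B" using D(2) bounded_iff by blast
    have "\<bar>t\<bar> \<le> B + norm x" if "t \<in> T" for t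
      using B[of "l t"] that norm_triangle_ineq4[of "l t" x] by (auto simp: T_def l_def)
    then have bT: "bounded T" unfolding bounded_iff real_norm_def by blast
    have "closed (l -` closure D)" using l by (simp add: closed_vimage)
    then have cl: "closure T \<subseteq> l -` closure D"
      unfolding T_def by (intro closure_minimal) (auto intro: closure_subset[THEN subsetD])
    have "(LINT t:T|lborel. pd i \<psi> (l t)) = 0"
    proof (cases "set_integrable lborel T (\<lambda>t. pd i \<psi> (l t))")
      case True
      show ?thesis
      proof (rule integral_derivative_open_zero[OF T bT _ _ _ _ True])
        show "continuous_on (closure T) (\<lambda>t. \<psi> (l t))"
          using cl by (intro continuous_on_compose2[OF cont l]) auto
        show "\<psi> (l t) = 0" if "t \<in> frontier T" for t
          using that cl T D(1) bd[of "l t"]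
          by (auto simp: frontier_def interior_open T_def)
        show "((\<lambda>t. \<psi> (l t)) has_real_derivative pd i \<psi> (l t)) (at t)" if "t \<in> T" for t
          using that line_has_real_derivative[of \<psi> x t i] d by (simp add: T_def l_def)
        show "continuous_on T (\<lambda>t. pd i \<psi> (l t))"
          by (intro continuous_on_compose2[OF c l]) (auto simp: T_def)
      qed
    next
      \<comment> \<open>Exceptional lines, on which the derivative is not integrable, contribute the default value 0.\<close>
      case False
      then show ?thesis
        unfolding set_lebesgue_integral_def set_integrable_def by (rule not_integrable_integral_eq)
    qed
    then show ?thesis
      by (simp add: set_lebesgue_integral_def T_def l_def indicator_def)
  qed
  then show ?thesis
    using integral_zero_if_line_integrals_zero[OF i[unfolded set_integrable_def] e]
    by (simp add: set_lebesgue_integral_def)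
qed

section \<open>The inverse and the determinant of a rank one perturbation of the identity\<close>

definition outer :: "real^'n::finite \<Rightarrow> real^'n^'n" where
  "outer p = (\<chi> i j. p $ i * p $ j)"

lemma matrix_inv_eqI:
  fixes A B :: "real^'n::finite^'n"
  assumes "A ** B = mat 1"
  shows "matrix_inv A = B"
proof -
  have BA: "B ** A = mat 1" using assms matrix_left_right_inverse by blast
  have "A ** matrix_inv A = mat 1 \<and> matrix_inv A ** A = mat 1"
    unfolding matrix_inv_def by (rule someI[of _ B]) (simp add: assms BA)
  then have "matrix_inv A ** A ** B = B" by simp
  then show ?thesis by (metis assms matrix_mul_assoc matrix_mul_rid)
qed

lemma matrix_add_mult_distrib:
  fixes A B C :: "real^'n::finite^'n"
  shows "(A + B) ** C = A ** C + B ** C"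
  by (simp add: matrix_matrix_mult_def vec_eq_iff sum.distrib distrib_right)

text \<open>As the square of \<open>outer p\<close> is a multiple of it, the inverse of \<open>mat 1 + outer p\<close> is found among
  the combinations of \<open>mat 1\<close> and \<open>outer p\<close>.\<close>

lemma outer_mult_outer: "outer p ** outer p = (norm p)\<^sup>2 *\<^sub>R outer p"
proof -
  have "(\<Sum>k\<in>UNIV. (p $ i * p $ k) * (p $ k * p $ j)) = (\<Sum>k\<in>UNIV. p $ k * p $ k) * (p $ i * p $ j)" for i j
    by (simp add: sum_distrib_left mult_ac)
  then show ?thesis
    by (simp add: outer_def matrix_matrix_mult_def vec_eq_iff power2_norm_eq_inner inner_vec_def)
qed

lemma matrix_inv_one_plus_outer:
  fixes p :: "real^'n::finite"
  assumes "c = 1 + (norm p)\<^sup>2"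
  shows "matrix_inv (mat 1 + outer p) = mat 1 - (1 / c) *\<^sub>R outer p"
proof (rule matrix_inv_eqI)
  have c: "c > 0" using assms by (simp add: add_pos_nonneg)
  have "(mat 1 + outer p) ** (mat 1 + (- (1 / c)) *\<^sub>R outer p)
      = mat 1 + outer p + (- (1 / c)) *\<^sub>R outer p + (- (1 / c)) *\<^sub>R (outer p ** outer p)"
    by (simp only: matrix_add_ldistrib matrix_add_mult_distrib matrix_scalar_ac
        matrix_mul_lid matrix_mul_rid add.assoc scaleR_add_right flip: scalar_matrix_assoc)
  also have "\<dots> = mat 1 + (1 - 1 / c - (c - 1) / c) *\<^sub>R outer p"
    by (simp add: outer_mult_outer assms algebra_simps)
  also have "\<dots> = mat 1" using c by (simp add: field_simps)
  finally show "(mat 1 + outer p) ** (mat 1 - (1 / c) *\<^sub>R outer p) = mat 1" by simp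
qed

text \<open>Rotating \<open>p\<close> to a multiple of a coordinate vector makes the matrix diagonal.\<close>

lemma det_one_plus_outer:
  fixes p :: "real^'n::finite"
  shows "det (mat 1 + outer p) = 1 + (norm p)\<^sup>2"
proof -
  fix k :: 'n
  let ?v = "norm p *\<^sub>R axis k 1 :: real^'n"
  have "norm p = norm ?v" by simp
  then obtain T where T: "orthogonal_transformation T" "T p = ?v"
    using orthogonal_transformation_exists by blast
  define Q where "Q = matrix T"
  have Q: "orthogonal_matrix Q" "linear T"
    using T(1) unfolding Q_def orthogonal_transformation_matrix by auto
  have Qp: "Q *v p = ?v" unfolding Q_def using T(2) Q(2) by (simp add: matrix_works)
  have out: "Q ** outer p ** transpose Q = outer (Q *v p)"
    unfolding outer_def matrix_matrix_mult_def matrix_vector_mult_def transpose_def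
    by (simp add: vec_eq_iff sum_distrib_left sum_distrib_right sum_product mult_ac)
  have "Q ** (mat 1 + outer p) ** transpose Q = mat 1 + outer ?v"
    using out Q(1) Qp
    by (simp add: matrix_add_ldistrib matrix_add_mult_distrib orthogonal_matrix_def)
  then have "det Q * det (mat 1 + outer p) * det Q = det (mat 1 + outer ?v)"
    by (metis det_mul det_transpose)
  moreover have "det Q * det Q = 1"
    using det_orthogonal_matrix[OF Q(1)] by auto
  moreover have "det (mat 1 + outer ?v) = 1 + (norm p)\<^sup>2"
  proof -
    have "det (mat 1 + outer ?v) = (\<Prod>i\<in>UNIV. if i = k then 1 + (norm p)\<^sup>2 else 1)"
      by (subst det_diagonal)
        (auto simp: mat_def outer_def axis_def power2_eq_square intro!: prod.cong simp del: prod.delta)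
    then show ?thesis by simp
  qed
  ultimately show ?thesis by (metis mult.assoc mult.commute mult_1)
qed

lemma trace_swap_square:
  fixes A B :: "real^'n::finite^'n"
  shows "trace ((A ** B) ** (A ** B)) = trace ((B ** A) ** (B ** A))"
proof -
  have "trace (A ** (B ** A ** B)) = trace ((B ** A ** B) ** A)" by (rule trace_mul_sym)
  then show ?thesis by (simp only: matrix_mul_assoc)
qed

section \<open>The geometry of a graph\<close>

definition grad :: "(real^'n::finite \<Rightarrow> real) \<Rightarrow> real^'n \<Rightarrow> real^'n" where
  "grad f x = (\<chi> i. pd i f x)"

definition slope_factor :: "(real^'n::finite \<Rightarrow> real) \<Rightarrow> real^'n \<Rightarrow> real" where
  "slope_factor f x = sqrt (1 + (norm (grad f x))\<^sup>2)"

text \<open>Up to sign, the horizontal part of the unit normal of the graph.\<close>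

definition normal_slope :: "(real^'n::finite \<Rightarrow> real) \<Rightarrow> real^'n \<Rightarrow> real^'n" where
  "normal_slope f x = grad f x /\<^sub>R slope_factor f x"

definition divergence :: "(real^'n::finite \<Rightarrow> real^'n) \<Rightarrow> real^'n \<Rightarrow> real" where
  "divergence F x = (\<Sum>i\<in>UNIV. pd i (\<lambda>y. F y $ i) x)"

lemma slope_factor_pos: "slope_factor f x > 0"
  unfolding slope_factor_def by (simp add: add_pos_nonneg)

lemma slope_factor_nonzero: "slope_factor f x \<noteq> 0"
  using slope_factor_pos[of f x] by simp

lemma slope_factor_sq: "(slope_factor f x)\<^sup>2 = 1 + (norm (grad f x))\<^sup>2"
  unfolding slope_factor_def by (simp add: add_nonneg_nonneg)

lemma norm_normal_slope_less_1: "norm (normal_slope f x) < 1"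
proof -
  have "norm (grad f x) < slope_factor f x"
    unfolding slope_factor_def by (rule real_less_rsqrt) simp
  then show ?thesis
    using slope_factor_pos[of f x] by (simp add: normal_slope_def divide_inverse_commute[symmetric] divide_simps)
qed

lemma outer_normal_slope:
  "outer (normal_slope f x) = (1 / (slope_factor f x)\<^sup>2) *\<^sub>R outer (grad f x)"
  by (simp add: outer_def normal_slope_def vec_eq_iff power2_eq_square field_simps)

lemma graph_normal_eq:
  "graph_normal \<sigma> f x = (- \<sigma> *\<^sub>R normal_slope f x, \<sigma> / slope_factor f x)"
  by (simp add: graph_normal_def slope_factor_def normal_slope_def grad_def Let_def divide_inverse)

lemma pd_graph_param:
  assumes "f differentiable (at x)"
  shows "pd i (graph_param f) x = (axis i 1, pd i f x)"
  using pd_eqI[OF has_derivative_Pair[OF has_derivative_ident has_derivative_pd[OF assms]]]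
  by (simp add: pd_def graph_param_def[abs_def])

lemma metric_graph:
  assumes "f differentiable (at x)"
  shows "metric (graph_param f) x = mat 1 + outer (grad f x)"
  by (simp add: metric_def pd_graph_param[OF assms] vec_eq_iff mat_def outer_def grad_def
      inner_axis_axis)

lemma area_element_graph:
  assumes "f differentiable (at x)"
  shows "area_element (graph_param f) x = slope_factor f x"
  by (simp add: area_element_def metric_graph[OF assms] det_one_plus_outer slope_factor_def)

lemma inverse_metric_graph:
  assumes "f differentiable (at x)"
  shows "matrix_inv (metric (graph_param f) x) = mat 1 - outer (normal_slope f x)"
  by (simp add: metric_graph[OF assms] matrix_inv_one_plus_outer[OF refl] outer_normal_slope slope_factor_sq)

locale smooth_graph =
  fixes U :: "(real^'n::finite) set" and f :: "real^'n \<Rightarrow> real"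
  assumes open_U: "open U" and smooth_f: "smooth_on U f"
begin

abbreviation W :: "real^'n \<Rightarrow> real" where "W \<equiv> slope_factor f"
abbreviation X :: "real^'n \<Rightarrow> real^'n" where "X \<equiv> normal_slope f"

lemma W_eq: "W = (\<lambda>x. sqrt (1 + (\<Sum>l\<in>UNIV. pd l f x * pd l f x)))"
  by (simp add: fun_eq_iff slope_factor_def norm_eq_sqrt_inner inner_vec_def grad_def sum_nonneg)

lemma X_nth: "X x $ k = pd k f x / W x"
  by (simp add: normal_slope_def grad_def divide_inverse_commute)

lemma differentiable_f: "x \<in> U \<Longrightarrow> f differentiable (at x)"
  using smooth_on_differentiable[OF smooth_f] .

lemma smooth_radicand: "smooth_on U (\<lambda>x. 1 + (\<Sum>l\<in>UNIV. pd l f x * pd l f x))"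
  by (intro smooth_on_add smooth_on_const smooth_on_sum smooth_on_mult smooth_on_pd open_U smooth_f)

lemma radicand_pos: "1 + (\<Sum>l\<in>UNIV. pd l f x * pd l f x) > 0"
  by (simp add: add_pos_nonneg sum_nonneg)

lemma smooth_W: "smooth_on U W"
  unfolding W_eq by (rule smooth_on_sqrt[OF open_U smooth_radicand radicand_pos])

lemma smooth_X: "smooth_on U (\<lambda>x. X x $ k)"
  unfolding X_nth
  by (intro smooth_on_divide open_U smooth_on_pd smooth_f smooth_W slope_factor_nonzero)

lemma pd_W:
  assumes "x \<in> U"
  shows "pd j W x = (\<Sum>l\<in>UNIV. X x $ l * pd j (pd l f) x)"
proof -
  have d: "pd l f differentiable (at x)" for l
    by (rule smooth_on_differentiable[OF smooth_on_pd[OF smooth_f] assms])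
  have sq: "(\<lambda>x. pd l f x * pd l f x) differentiable (at x)"
    "pd j (\<lambda>x. pd l f x * pd l f x) x = 2 * (pd l f x * pd j (pd l f) x)" for l
    using pd_mult[OF d[of l] d[of l], of j] differentiable_mult[OF d[of l] d[of l]] by simp_all
  have "pd j (\<lambda>x. 1 + (\<Sum>l\<in>UNIV. pd l f x * pd l f x)) x
      = pd j (\<lambda>x. 1) x + pd j (\<lambda>x. \<Sum>l\<in>UNIV. pd l f x * pd l f x) x"
    by (rule pd_add) (use sq(1) in \<open>auto intro: differentiable_sum\<close>)
  also have "\<dots> = (\<Sum>l\<in>UNIV. 2 * (pd l f x * pd j (pd l f) x))"
    using sq by (simp add: pd_sum)
  finally have radicand: "pd j (\<lambda>x. 1 + (\<Sum>l\<in>UNIV. pd l f x * pd l f x)) x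
      = (\<Sum>l\<in>UNIV. 2 * (pd l f x * pd j (pd l f) x))" .
  have "pd j W x = inverse (2 * W x) * (\<Sum>l\<in>UNIV. 2 * (pd l f x * pd j (pd l f) x))"
    using pd_sqrt(1)[OF smooth_on_differentiable[OF smooth_radicand assms] radicand_pos, of j]
    unfolding W_eq radicand .
  also have "\<dots> = (\<Sum>l\<in>UNIV. X x $ l * pd j (pd l f) x)"
    unfolding sum_distrib_left
    by (intro sum.cong refl) (simp add: X_nth field_simps slope_factor_nonzero)
  finally show ?thesis .
qed

lemma pd_X:
  assumes "x \<in> U"
  shows "pd j (\<lambda>y. X y $ k) x = (pd j (pd k f) x - X x $ k * pd j W x) / W x"
proof -
  have d: "pd k f differentiable (at x)" "W differentiable (at x)"
    by (rule smooth_on_differentiable[OF smooth_on_pd[OF smooth_f] assms],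
        rule smooth_on_differentiable[OF smooth_W assms])
  have W: "W x \<noteq> 0" using slope_factor_pos[of f x] by simp
  have "pd j (\<lambda>y. X y $ k) x = pd k f x * (- (inverse (W x) * inverse (W x)) * pd j W x)
      + pd j (pd k f) x * inverse (W x)"
    unfolding X_nth divide_inverse pd_mult[OF d(1) pd_inverse(2)[OF d(2) W]]
      pd_inverse(1)[OF d(2) W] ..
  then show ?thesis by (simp add: X_nth field_simps W)
qed

lemma pd_pd_graph_param:
  assumes "x \<in> U"
  shows "pd i (pd j (graph_param f)) x = (0, pd i (pd j f) x)"
proof -
  have "pd i (pd j (graph_param f)) x = pd i (\<lambda>y. (axis j 1 :: real^'n, pd j f y)) x"
    by (rule pd_cong_open[OF open_U assms]) (simp add: pd_graph_param differentiable_f)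
  also have "\<dots> = (0, pd i (pd j f) x)"
    using pd_eqI[OF has_derivative_Pair[OF has_derivative_const[of "axis j 1 :: real^'n"]
      has_derivative_pd[OF smooth_on_differentiable[OF smooth_on_pd[OF smooth_f, of j] assms]]]]
    by (simp add: pd_def)
  finally show ?thesis .
qed

text \<open>The left-hand side is the transpose of the shape operator, as both factors are symmetric.  So
  the traces of the shape operator and of its square are those of the Jacobian matrix of \<open>X\<close>.\<close>

lemma second_form_mult_inverse_metric:
  assumes "x \<in> U"
  shows "second_form (graph_param f) (graph_normal \<sigma> f) x ** matrix_inv (metric (graph_param f) x)
    = \<sigma> *\<^sub>R (\<chi> j k. pd j (\<lambda>y. X y $ k) x)" (is "?A = ?B")
proof -
  have "?A $ j $ k = ?B $ j $ k" for j k
  proof -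
    have "?A $ j $ k = (\<Sum>l\<in>UNIV. \<sigma> * pd j (pd l f) x / W x
        * ((if l = k then 1 else 0) - X x $ l * X x $ k))"
      using assms by (simp add: inverse_metric_graph differentiable_f second_form_def
          pd_pd_graph_param graph_normal_eq matrix_matrix_mult_def mat_def outer_def mult_ac)
    also have "\<dots> = \<sigma> / W x * (\<Sum>l\<in>UNIV. (if l = k then pd j (pd l f) x else 0)
        - X x $ k * (X x $ l * pd j (pd l f) x))"
      unfolding sum_distrib_left by (rule sum.cong) (auto simp: algebra_simps)
    also have "\<dots> = \<sigma> / W x * (pd j (pd k f) x - X x $ k * pd j W x)"
      by (simp add: sum_subtractf pd_W[OF assms] sum_distrib_left)
    finally show ?thesis by (simp add: pd_X[OF assms])
  qed
  then show ?thesis by (simp add: vec_eq_iff)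
qed

lemma mean_curvature_graph:
  assumes "x \<in> U"
  shows "real CARD('n) * mean_curvature (graph_param f) (graph_normal \<sigma> f) x
    = \<sigma> * divergence X x"
proof -
  have "trace (shape_operator (graph_param f) (graph_normal \<sigma> f) x)
      = trace (\<sigma> *\<^sub>R (\<chi> j k. pd j (\<lambda>y. X y $ k) x))"
    unfolding shape_operator_def
    by (subst trace_mul_sym) (simp add: second_form_mult_inverse_metric[OF assms])
  also have "\<dots> = \<sigma> * divergence X x"
    by (simp add: trace_def divergence_def sum_distrib_left)
  finally show ?thesis by (simp add: mean_curvature_def)
qed

lemma second_form_norm_sq_graph:
  assumes "x \<in> U" "\<sigma> * \<sigma> = 1"
  shows "second_form_norm_sq (graph_param f) (graph_normal \<sigma> f) x
    = (\<Sum>i\<in>UNIV. \<Sum>j\<in>UNIV. pd i (\<lambda>y. X y $ j) x * pd j (\<lambda>y. X y $ i) x)"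
proof -
  let ?h = "second_form (graph_param f) (graph_normal \<sigma> f) x"
  let ?g = "matrix_inv (metric (graph_param f) x)"
  let ?J = "\<chi> j k. pd j (\<lambda>y. X y $ k) x"
  have "second_form_norm_sq (graph_param f) (graph_normal \<sigma> f) x = trace ((?g ** ?h) ** (?g ** ?h))"
    by (simp only: second_form_norm_sq_def shape_operator_def)
  also have "\<dots> = trace ((?h ** ?g) ** (?h ** ?g))"
    by (rule trace_swap_square)
  also have "\<dots> = trace ((\<sigma> *\<^sub>R ?J) ** (\<sigma> *\<^sub>R ?J))"
    by (simp only: second_form_mult_inverse_metric[OF assms(1)])
  also have "\<dots> = (\<Sum>i\<in>UNIV. \<Sum>j\<in>UNIV. (\<sigma> * \<sigma>) * (pd i (\<lambda>y. X y $ j) x * pd j (\<lambda>y. X y $ i) x))"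
    unfolding trace_def matrix_matrix_mult_def
    by (intro sum.cong refl) (simp add: mult_ac)
  finally show ?thesis using assms(2) by simp
qed

end

section \<open>The divergence of vector fields on the base\<close>

corollary integral_divergence_zero:
  fixes D :: "(real^'n::finite) set" and Z :: "real^'n \<Rightarrow> real^'n"
  assumes "open D" "bounded D"
    and "\<And>i. continuous_on (closure D) (\<lambda>x. Z x $ i)" "\<And>x. x \<in> frontier D \<Longrightarrow> Z x = 0"
    and "\<And>i x. x \<in> D \<Longrightarrow> (\<lambda>y. Z y $ i) differentiable (at x)"
    and "\<And>i. continuous_on D (pd i (\<lambda>y. Z y $ i))"
    and int: "\<And>i. set_integrable lborel D (pd i (\<lambda>y. Z y $ i))"
  shows "set_integrable lborel D (divergence Z)" "(LINT x:D|lborel. divergence Z x) = 0"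
proof -
  have "(LINT x:D|lborel. pd i (\<lambda>y. Z y $ i) x) = 0" for i
    by (rule integral_pd_zero) (use assms in auto)
  moreover have "(LINT x:D|lborel. divergence Z x) = (\<Sum>i\<in>UNIV. LINT x:D|lborel. pd i (\<lambda>y. Z y $ i) x)"
    using int unfolding divergence_def set_lebesgue_integral_def set_integrable_def scaleR_sum_right
    by (intro Bochner_Integration.integral_sum)
  ultimately show "(LINT x:D|lborel. divergence Z x) = 0" by simp
  show "set_integrable lborel D (divergence Z)"
    using int unfolding divergence_def[abs_def] set_integrable_def scaleR_sum_right
    by (intro Bochner_Integration.integrable_sum)
qed

lemma set_integrable_continuous_compact:
  fixes F :: "'a::euclidean_space \<Rightarrow> real"
  assumes "compact K" "continuous_on K F" "D \<subseteq> K" "D \<in> sets borel"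
  shows "set_integrable lborel D F"
  using set_integrable_subset[of lborel K F D] borel_integrable_compact[OF assms(1,2)] assms(3,4)
  by (simp add: set_integrable_def)

lemma grad_mult:
  assumes "\<phi> differentiable (at x)" "\<psi> differentiable (at x)"
  shows "grad (\<lambda>y. \<phi> y * \<psi> y) x = \<phi> x *\<^sub>R grad \<psi> x + \<psi> x *\<^sub>R grad \<phi> x"
  by (simp add: grad_def vec_eq_iff pd_mult[OF assms])

lemma divergence_scaleR:
  assumes "\<phi> differentiable (at x)" "\<And>i. (\<lambda>y. F y $ i) differentiable (at x)"
  shows "divergence (\<lambda>y. \<phi> y *\<^sub>R F y) x = \<phi> x * divergence F x + grad \<phi> x \<bullet> F x"
  by (simp add: divergence_def grad_def inner_vec_def pd_mult[OF assms] sum.distrib sum_distrib_left)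

lemma divergence_add:
  assumes "\<And>i. (\<lambda>y. F y $ i) differentiable (at x)" "\<And>i. (\<lambda>y. G y $ i) differentiable (at x)"
  shows "divergence (\<lambda>y. F y + G y) x = divergence F x + divergence G x"
  by (simp add: divergence_def pd_add[OF assms] sum.distrib)

text \<open>The derivative of \<open>F\<close> along itself, \<open>(F \<bullet> grad) F\<close>.\<close>

definition convective :: "(real^'n::finite \<Rightarrow> real^'n) \<Rightarrow> real^'n \<Rightarrow> real^'n" where
  "convective F x = (\<chi> i. \<Sum>j\<in>UNIV. F x $ j * pd j (\<lambda>y. F y $ i) x)"

lemma smooth_convective:
  assumes "open S" "\<And>i. smooth_on S (\<lambda>y. F y $ i)"
  shows "smooth_on S (\<lambda>y. convective F y $ i)"
  unfolding convective_def vec_lambda_beta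
  by (intro smooth_on_sum smooth_on_mult smooth_on_pd assms)

text \<open>The second derivatives of \<open>F\<close> enter only through the gradient of its divergence,
  because partial derivatives commute.\<close>

lemma divergence_convective:
  assumes S: "open S" "x \<in> S" and F: "\<And>i. smooth_on S (\<lambda>y. F y $ i)"
  shows "divergence (convective F) x
    = (\<Sum>i\<in>UNIV. \<Sum>j\<in>UNIV. pd i (\<lambda>y. F y $ j) x * pd j (\<lambda>y. F y $ i) x)
      + F x \<bullet> grad (divergence F) x"
proof -
  have d: "(\<lambda>y. F y $ i) differentiable (at x)" "pd j (\<lambda>y. F y $ i) differentiable (at x)" for i j
    using smooth_on_differentiable[OF _ S(2)] smooth_on_pd F by blast+
  have "pd i (\<lambda>y. convective F y $ i) x = (\<Sum>j\<in>UNIV. F x $ j * pd j (pd i (\<lambda>y. F y $ i)) x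
      + pd i (\<lambda>y. F y $ j) x * pd j (\<lambda>y. F y $ i) x)" for i
  proof -
    have "pd i (\<lambda>y. F y $ j * pd j (\<lambda>y. F y $ i) y) x = F x $ j * pd j (pd i (\<lambda>y. F y $ i)) x
        + pd i (\<lambda>y. F y $ j) x * pd j (\<lambda>y. F y $ i) x" for j
      using pd_mult[OF d(1)[of j] d(2)[of j i], of i] pd_commute[OF S, of "\<lambda>y. F y $ i" i j] F
      unfolding smooth_on_def by simp
    moreover have "(\<lambda>y. F y $ j * pd j (\<lambda>y. F y $ i) y) differentiable (at x)" for j
      by (intro differentiable_mult d)
    ultimately show ?thesis by (simp add: convective_def pd_sum)
  qed
  moreover have "pd j (divergence F) x = (\<Sum>i\<in>UNIV. pd j (pd i (\<lambda>y. F y $ i)) x)" for j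
    unfolding divergence_def[abs_def] by (rule pd_sum) (rule d)
  then have "F x \<bullet> grad (divergence F) x
      = (\<Sum>i\<in>UNIV. \<Sum>j\<in>UNIV. F x $ j * pd j (pd i (\<lambda>y. F y $ i)) x)"
    by (simp add: inner_vec_def grad_def sum_distrib_left) (rule sum.swap)
  ultimately show ?thesis
    by (simp add: divergence_def sum.distrib)
qed

section \<open>The second variation of a graph\<close>

context smooth_graph
begin

text \<open>The inverse of the induced metric, \<open>mat 1 - outer (X x)\<close>, applied to \<open>v\<close>; on a gradient it
  raises the index.\<close>

definition sharp :: "real^'n \<Rightarrow> real^'n \<Rightarrow> real^'n" where
  "sharp x v = v - (X x \<bullet> v) *\<^sub>R X x"

lemma inner_sharp: "a \<bullet> sharp x b = a \<bullet> b - (X x \<bullet> a) * (X x \<bullet> b)"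
  by (simp add: sharp_def inner_diff_right inner_commute)

lemma sharp_nonneg: "c \<bullet> sharp x c \<ge> 0"
proof -
  have "\<bar>X x \<bullet> c\<bar> \<le> norm (X x) * norm c" by (rule Cauchy_Schwarz_ineq2)
  also have "\<dots> \<le> norm c"
    using norm_normal_slope_less_1[of f x] by (simp add: mult_left_le_one_le)
  finally have "(X x \<bullet> c)\<^sup>2 \<le> (norm c)\<^sup>2"
    by (metis abs_ge_zero power2_abs power_mono)
  then show ?thesis by (simp add: inner_sharp power2_norm_eq_inner flip: power2_eq_square)
qed

text \<open>Differentiating \<open>W\<^sup>2 = 1 + \<bar>p\<bar>\<^sup>2\<close> gives \<open>grad W = Hess f X\<close>, by the symmetry of the Hessian; the
  same contraction \<open>Hess f X\<close> arises when \<open>X = p / W\<close> is differentiated along \<open>X\<close>.\<close>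

lemma convective_X:
  assumes "x \<in> U"
  shows "convective X x = sharp x (grad W x) /\<^sub>R W x"
proof -
  have C2: "Ck_on 2 U f" using smooth_f unfolding smooth_on_def by blast
  have "convective X x $ i = (sharp x (grad W x) /\<^sub>R W x) $ i" for i
  proof -
    have "convective X x $ i = (\<Sum>j\<in>UNIV. X x $ j * pd j (pd i f) x - X x $ i * (X x $ j * pd j W x)) / W x"
      by (simp add: convective_def pd_X[OF assms] sum_divide_distrib algebra_simps)
    also have "\<dots> = (pd i W x - X x $ i * (X x \<bullet> grad W x)) / W x"
      using pd_commute[OF open_U assms C2]
      by (simp add: sum_subtractf pd_W[OF assms, of i] inner_vec_def grad_def sum_distrib_left)
    also have "\<dots> = (sharp x (grad W x) /\<^sub>R W x) $ i"
      by (simp add: sharp_def grad_def field_simps slope_factor_nonzero)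
    finally show ?thesis .
  qed
  then show ?thesis by (simp add: vec_eq_iff)
qed

text \<open>The gradient of \<open>u\<close> on the graph times the area density; its divergence on the base is
  \<open>W\<close> times the Laplacian of \<open>u\<close> on the graph.\<close>

definition flux :: "(real^'n \<Rightarrow> real) \<Rightarrow> real^'n \<Rightarrow> real^'n" where
  "flux u y = W y *\<^sub>R sharp y (grad u y)"

lemma laplace_beltrami_graph:
  assumes "x \<in> U"
  shows "laplace_beltrami (graph_param f) u x = divergence (flux u) x / W x"
proof -
  have "area_element (graph_param f) y *
      (\<Sum>j\<in>UNIV. matrix_inv (metric (graph_param f) y) $ i $ j * pd j u y) = flux u y $ i"
    if "y \<in> U" for y i
  proof -
    have "(\<Sum>j\<in>UNIV. (mat 1 - outer (X y)) $ i $ j * pd j u y)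
        = (\<Sum>j\<in>UNIV. (if i = j then pd j u y else 0) - X y $ i * (X y $ j * pd j u y))"
      by (rule sum.cong) (auto simp: mat_def outer_def algebra_simps)
    also have "\<dots> = sharp y (grad u y) $ i"
      by (simp add: sum_subtractf sharp_def grad_def inner_vec_def sum_distrib_left mult_ac)
    finally show ?thesis
      using that by (simp add: flux_def area_element_graph inverse_metric_graph differentiable_f)
  qed
  then have "pd i (\<lambda>y. area_element (graph_param f) y *
      (\<Sum>j\<in>UNIV. matrix_inv (metric (graph_param f) y) $ i $ j * pd j u y)) x
      = pd i (\<lambda>y. flux u y $ i) x" for i
    by (intro pd_cong_open[OF open_U assms])
  then show ?thesis
    using assms by (simp add: laplace_beltrami_def divergence_def area_element_graph differentiable_f)
qed

lemma smooth_flux: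
  assumes "smooth_on U u"
  shows "smooth_on U (\<lambda>y. flux u y $ i)"
proof -
  have "flux u y $ i = W y * (pd i u y + (- 1) * ((\<Sum>j\<in>UNIV. X y $ j * pd j u y) * X y $ i))" for y
    by (simp add: flux_def sharp_def grad_def inner_vec_def)
  then show ?thesis
    by (simp only:) (intro smooth_on_mult smooth_on_add smooth_on_sum smooth_on_const smooth_on_pd
      assms smooth_W smooth_X open_U)
qed

text \<open>The divergence of the first summand brings in the Laplacian of \<open>u\<close>, that of the second the term
  \<open>\<bar>A\<bar>\<^sup>2 u\<^sup>2\<close>.\<close>

definition jacobi_flux :: "(real^'n \<Rightarrow> real) \<Rightarrow> real^'n \<Rightarrow> real^'n" where
  "jacobi_flux u y = u y *\<^sub>R flux u y + (u y * u y * W y) *\<^sub>R convective X y"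

lemma smooth_jacobi_flux:
  assumes "smooth_on U u"
  shows "smooth_on U (\<lambda>y. jacobi_flux u y $ i)"
  unfolding jacobi_flux_def vector_add_component vector_scaleR_component real_scaleR_def
  by (intro smooth_on_mult smooth_on_add smooth_flux smooth_convective smooth_X smooth_W open_U assms)

text \<open>The divergence of \<open>convective X\<close> is \<open>\<bar>A\<bar>\<^sup>2 + X \<bullet> grad (divergence X)\<close>, so \<open>\<bar>A\<bar>\<^sup>2 u\<^sup>2 W\<close> is up to a
  divergence a product of \<open>convective X\<close> with \<open>grad (u\<^sup>2 W)\<close>.  As \<open>convective X\<close> is itself
  \<open>sharp (grad W) / W\<close>, the result completes \<open>grad u \<bullet> flux u\<close> to a square.

  The vector \<open>c\<close> is \<open>grad (u W) / W\<close>, where up to sign \<open>u W\<close> is the speed of the vertical variation of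
  the graph whose normal component is \<open>u\<close>.\<close>

proposition jacobi_operator_identity:
  assumes x: "x \<in> U" and u: "smooth_on U u" and \<sigma>: "\<sigma> * \<sigma> = 1"
    and c: "c = grad u x + (u x / W x) *\<^sub>R grad W x"
  shows "u x * (laplace_beltrami (graph_param f) u x
        + second_form_norm_sq (graph_param f) (graph_normal \<sigma> f) x * u x) * W x
    = divergence (jacobi_flux u) x - W x * (c \<bullet> sharp x c)
      - (u x)\<^sup>2 * W x * (X x \<bullet> grad (divergence X) x)"
proof -
  note d = smooth_on_differentiable[OF _ x]
  let ?A = "second_form_norm_sq (graph_param f) (graph_normal \<sigma> f) x"
  let ?R = "X x \<bullet> grad (divergence X) x"
  have W: "W x \<noteq> 0" by (rule slope_factor_nonzero)
  have du: "u differentiable (at x)" "W differentiable (at x)"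
    using d u smooth_W by blast+
  have dF: "(\<lambda>y. flux u y $ i) differentiable (at x)" "(\<lambda>y. convective X y $ i) differentiable (at x)" for i
    using d[OF smooth_flux[OF u]] d[OF smooth_convective[OF open_U smooth_X]] by blast+
  have duu: "(\<lambda>y. u y * u y) differentiable (at x)" "(\<lambda>y. u y * u y * W y) differentiable (at x)"
    using du by (simp_all add: differentiable_mult)
  have "divergence (jacobi_flux u) x
      = divergence (\<lambda>y. u y *\<^sub>R flux u y) x + divergence (\<lambda>y. (u y * u y * W y) *\<^sub>R convective X y) x"
    unfolding jacobi_flux_def[abs_def]
    by (rule divergence_add) (use du duu dF in \<open>simp_all add: differentiable_mult\<close>)
  also have "divergence (\<lambda>y. u y *\<^sub>R flux u y) x = u x * divergence (flux u) x + grad u x \<bullet> flux u x"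
    by (rule divergence_scaleR[OF du(1) dF(1)])
  also have "divergence (\<lambda>y. (u y * u y * W y) *\<^sub>R convective X y) x
      = (u x * u x * W x) * (?A + ?R) + grad (\<lambda>y. u y * u y * W y) x \<bullet> convective X x"
    using divergence_convective[OF open_U x smooth_X]
    by (simp add: divergence_scaleR[OF duu(2) dF(2)] second_form_norm_sq_graph[OF x \<sigma>])
  also have "grad (\<lambda>y. u y * u y * W y) x = (2 * u x * W x) *\<^sub>R grad u x + (u x * u x) *\<^sub>R grad W x"
    by (simp add: grad_mult[OF duu(1) du(2)] grad_mult[OF du(1) du(1)] scaleR_add_right
        flip: scaleR_add_left)
  finally have div: "divergence (jacobi_flux u) x = u x * divergence (flux u) x + grad u x \<bullet> flux u x
      + ((u x * u x * W x) * (?A + ?R)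
      + ((2 * u x * W x) *\<^sub>R grad u x + (u x * u x) *\<^sub>R grad W x) \<bullet> convective X x)" .
  \<comment> \<open>Completion of the square; \<open>sharp\<close> is self-adjoint, so the mixed terms agree.\<close>
  have "grad u x \<bullet> flux u x
      + ((2 * u x * W x) *\<^sub>R grad u x + (u x * u x) *\<^sub>R grad W x) \<bullet> convective X x
      = W x * (c \<bullet> sharp x c)"
    unfolding c flux_def convective_X[OF x]
    by (simp add: inner_sharp inner_add_left inner_add_right inner_commute W field_simps power2_eq_square)
  moreover have "u x * (laplace_beltrami (graph_param f) u x + ?A * u x) * W x
      = u x * divergence (flux u) x + u x * u x * W x * ?A"
    by (simp add: laplace_beltrami_graph[OF x] W field_simps)
  ultimately show ?thesis
    using div by (simp add: algebra_simps power2_eq_square)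
qed

end

section \<open>Powers of the height\<close>

text \<open>The two branches of \<open>height_power\<close>, described so that the exponent \<open>m - 1\<close> of the derivative falls
  into the same branch.\<close>

lemma admissible_height_cases:
  assumes "admissible_height m t" "m > 0"
  obtains (power) k where "m = real (Suc k)" "even (Suc k) \<Longrightarrow> 0 \<le> t"
  | (powr) "m \<notin> \<nat>" "m - 1 \<notin> \<nat>" "0 < t"
proof (cases "m \<in> \<nat>")
  case True
  then obtain n where "m = real n" by (auto elim: Nats_cases)
  with assms obtain k where "n = Suc k" by (cases n) auto
  with \<open>m = real n\<close> show ?thesis
    using assms(1) power[of k] unfolding admissible_height_def by blast
next
  case False
  then have "m - 1 \<notin> \<nat>" using Nats_add[of "m - 1" 1] by auto
  then show ?thesis using False assms(1) powr unfolding admissible_height_def by blast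
qed

lemma height_power_of_nat [simp]: "height_power t (real k) = t ^ k"
  by (simp add: height_power_def)

lemma height_power_has_derivative:
  assumes "admissible_height m t" "m > 0"
  shows "((\<lambda>s. height_power s m) has_real_derivative m * height_power t (m - 1)) (at t)"
  using assms
proof (cases rule: admissible_height_cases)
  case (power k)
  then have "m - 1 = real k" by simp
  then show ?thesis
    using DERIV_pow[of "Suc k" t] unfolding power(1) by (simp only: height_power_of_nat) simp
next
  case powr
  then show ?thesis
    using has_real_derivative_powr[of t m] by (simp add: height_power_def)
qed

text \<open>For even \<open>m\<close> the exponent \<open>m - 1\<close> is odd, and the claim would fail at negative heights.\<close>

lemma height_power_deriv_nonneg:
  assumes "admissible_height m t" "m > 0"
  shows "height_power t (m - 1) \<ge> 0"
  using assms
proof (cases rule: admissible_height_cases)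
  case (power k)
  then have "m - 1 = real k" by simp
  then have eq: "height_power t (m - 1) = t ^ k" by simp
  show ?thesis
  proof (cases "even k")
    case True
    then show ?thesis unfolding eq by (rule zero_le_even_power)
  next
    case False
    then show ?thesis using power(2) by (simp add: eq)
  qed
qed (simp add: height_power_def)

section \<open>Stability\<close>

context smooth_graph
begin

lemma stationary_divergence:
  assumes "stationary \<eta> m lam D (graph_param f) (graph_normal \<sigma> f)" "\<sigma> * \<sigma> = 1"
    and "D \<subseteq> U" "x \<in> D"
  shows "divergence X x = \<sigma> * (\<eta> * height_power (f x) m + lam)"
proof -
  have "x \<in> U" using assms by blast
  then have "\<sigma> * divergence X x = \<eta> * height_power (f x) m + lam"
    using assms(1,4) mean_curvature_graph[of x \<sigma>] by (simp add: stationary_def graph_param_def)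
  then show ?thesis using assms(2) by (metis mult.assoc mult_1)
qed

text \<open>Stationarity prescribes \<open>divergence X\<close> as a function of the height that increases, because
  \<open>\<eta> \<sigma> > 0\<close>, and \<open>X\<close> points in the direction in which the height grows.\<close>

lemma grad_divergence_X_nonneg:
  assumes st: "stationary \<eta> m lam D (graph_param f) (graph_normal \<sigma> f)" and \<sigma>: "\<sigma> * \<sigma> = 1"
    and D: "open D" "D \<subseteq> U" "x \<in> D"
    and adm: "admissible_height m (f x)" and m: "m > 0" and pos: "\<eta> * \<sigma> > 0"
  shows "X x \<bullet> grad (divergence X) x \<ge> 0"
proof -
  have x: "x \<in> U" using D by blast
  let ?h = "\<sigma> * (\<eta> * (m * height_power (f x) (m - 1)))"
  have "pd i (divergence X) x = ?h * pd i f x" for i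
  proof -
    have "pd i (divergence X) x = pd i (\<lambda>y. \<sigma> * (\<eta> * height_power (f y) m + lam)) x"
      by (rule pd_cong_open[OF D(1,3)]) (rule stationary_divergence[OF st \<sigma> D(2)])
    also have "\<dots> = ?h * pd i f x"
      by (rule pd_comp_real(1)[OF differentiable_f[OF x]])
        (auto intro!: derivative_eq_intros height_power_has_derivative[OF adm m])
    finally show ?thesis .
  qed
  then have "grad (divergence X) x = ?h *\<^sub>R grad f x"
    by (simp add: grad_def vec_eq_iff)
  then have "X x \<bullet> grad (divergence X) x = (\<eta> * \<sigma>) * m * height_power (f x) (m - 1) * (grad f x \<bullet> grad f x) / W x"
    by (simp add: normal_slope_def field_simps)
  then show ?thesis
    using pos m height_power_deriv_nonneg[OF adm m] slope_factor_pos[of f x] by simp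
qed

text \<open>The divergence in \<open>jacobi_operator_identity\<close> integrates to zero.  What remains is the sum of a
  square and of two multiples of \<open>u\<^sup>2\<close> with nonnegative coefficients: one from the variation of the
  mean curvature along the graph, one from the potential in the Jacobi operator.\<close>

proposition second_variation_nonneg:
  assumes st: "stationary \<eta> m lam D (graph_param f) (graph_normal \<sigma> f)" and \<sigma>: "\<sigma> * \<sigma> = 1"
    and D: "open D" "compact (closure D)" "closure D \<subseteq> U"
    and adm: "\<And>x. x \<in> D \<Longrightarrow> admissible_height m (f x)" and m: "m > 0" and pos: "\<eta> * \<sigma> > 0"
    and u: "test_function D u"
  shows "second_variation \<eta> m D (graph_param f) (graph_normal \<sigma> f) u \<ge> 0"
proof -
  have DU: "D \<subseteq> U" using D(3) closure_subset by blast
  have su: "smooth_on U u" using u smooth_on_subset unfolding test_function_def by blast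
  let ?Z = "jacobi_flux u"
  have sZ: "smooth_on U (\<lambda>y. ?Z y $ i)" for i by (rule smooth_jacobi_flux[OF su])
  have supp: "u x = 0" if "x \<notin> D" for x
    using u that closure_subset[of "{x. u x \<noteq> 0}"] unfolding test_function_def by blast
  have meas: "D \<in> sets borel" using D(1) by simp
  have iZ: "set_integrable lborel D (pd i (\<lambda>y. ?Z y $ i))" for i
    using smooth_on_continuous[OF smooth_on_pd[OF sZ]] continuous_on_subset D(3) closure_subset
    by (intro set_integrable_continuous_compact[OF D(2) _ _ meas]) blast+
  have Z: "set_integrable lborel D (divergence ?Z)" "(LINT x:D|lborel. divergence ?Z x) = 0"
  proof -
    have 1: "bounded D" using D(2) bounded_subset closure_subset compact_imp_bounded by metis
    have 2: "continuous_on (closure D) (\<lambda>y. ?Z y $ i)" for i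
      using smooth_on_continuous[OF sZ] D(3) continuous_on_subset by blast
    have 3: "?Z x = 0" if "x \<in> frontier D" for x
      using that supp[of x] D(1) by (simp add: jacobi_flux_def frontier_def interior_open)
    have 4: "(\<lambda>y. ?Z y $ i) differentiable (at x)" if "x \<in> D" for i x
      using smooth_on_differentiable[OF sZ] that DU by blast
    have 5: "continuous_on D (pd i (\<lambda>y. ?Z y $ i))" for i
      using smooth_on_continuous[OF smooth_on_pd[OF sZ]] continuous_on_subset DU by blast
    show "set_integrable lborel D (divergence ?Z)" "(LINT x:D|lborel. divergence ?Z x) = 0"
      using integral_divergence_zero[OF D(1) 1 2 3 4 5 iZ] by blast+
  qed
  define I where "I x = - (u x * jacobi_operator \<eta> m (graph_param f) (graph_normal \<sigma> f) u x
    * area_element (graph_param f) x)" for x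
  have Q: "I x + divergence ?Z x \<ge> 0" if "x \<in> D" for x
  proof -
    have x: "x \<in> U" using that DU by blast
    define c where "c = grad u x + (u x / W x) *\<^sub>R grad W x"
    have W: "W x > 0" by (rule slope_factor_pos)
    have "I x = - (u x * (laplace_beltrami (graph_param f) u x
        + second_form_norm_sq (graph_param f) (graph_normal \<sigma> f) x * u x) * W x)
        + (\<eta> * \<sigma>) * m * height_power (f x) (m - 1) * (u x)\<^sup>2"
      using W by (simp add: I_def jacobi_operator_def area_element_graph[OF differentiable_f[OF x]]
          graph_normal_eq graph_param_def field_simps power2_eq_square)
    then have "I x + divergence ?Z x = W x * (c \<bullet> sharp x c)
        + (u x)\<^sup>2 * W x * (X x \<bullet> grad (divergence X) x)
        + (\<eta> * \<sigma>) * m * height_power (f x) (m - 1) * (u x)\<^sup>2"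
      using jacobi_operator_identity[OF x su \<sigma> c_def] by linarith
    then show ?thesis
      using W sharp_nonneg[of c x] m pos height_power_deriv_nonneg[OF adm[OF that] m]
        grad_divergence_X_nonneg[OF st \<sigma> D(1) DU that adm[OF that] m pos]
      by simp
  qed
  have "(LINT x:D|lborel. I x) \<ge> 0"
  proof (cases "set_integrable lborel D I")
    case True
    have "0 \<le> (LINT x:D|lborel. I x + divergence ?Z x)"
      using Q by (simp add: set_lebesgue_integral_def integral_nonneg indicator_def)
    also have "\<dots> = (LINT x:D|lborel. I x)"
      using Z True by (simp add: set_integral_add)
    finally show ?thesis .
  next
    \<comment> \<open>The integral of a function that is not integrable is 0 by definition.\<close>
    case False
    then show ?thesis
      by (simp add: set_lebesgue_integral_def set_integrable_def not_integrable_integral_eq)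
  qed
  then show ?thesis
    by (simp add: second_variation_def I_def[abs_def] set_lebesgue_integral_def)
qed

end

section \<open>The potential energy of a graph\<close>

lemma set_integrable_bounded_measurable:
  fixes w :: "'a::euclidean_space \<Rightarrow> real"
  assumes "S \<in> sets borel" "bounded S" "w \<in> borel_measurable borel"
    and "\<And>x. x \<in> S \<Longrightarrow> \<bar>w x\<bar> \<le> B"
  shows "set_integrable lborel S w"
  unfolding set_integrable_def
  by (rule integrableI_bounded_set_indicator[where B=B])
    (use assms emeasure_bounded_finite[OF assms(2)] in auto)

text \<open>Where \<open>h \<le> l\<close>, the vertical slice is empty.  With one of the two functions equal to \<open>0\<close>, this
  describes the part of the enclosed domain above, or below, the hyperplane at height \<open>0\<close>.\<close>

lemma set_integral_between_graphs:
  fixes D :: "'a::euclidean_space set" and l h :: "'a \<Rightarrow> real" and w :: "real \<Rightarrow> real"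
  assumes D: "open D" "bounded D" and cont: "continuous_on D l" "continuous_on D h"
    and lh: "\<And>x. x \<in> D \<Longrightarrow> - M \<le> l x" "\<And>x. x \<in> D \<Longrightarrow> h x \<le> M"
    and w: "w \<in> borel_measurable borel"
    and bound: "\<And>x t. x \<in> D \<Longrightarrow> l x < t \<Longrightarrow> t < h x \<Longrightarrow> \<bar>w t\<bar> \<le> B"
  shows "set_integrable lborel D (\<lambda>x. LINT t:{l x<..<h x}|lborel. w t)"
    and "(LINT p:{p. fst p \<in> D \<and> l (fst p) < snd p \<and> snd p < h (fst p)}|lborel. w (snd p))
      = (LINT x:D|lborel. LINT t:{l x<..<h x}|lborel. w t)"
proof -
  define S where "S = {p. fst p \<in> D \<and> l (fst p) < snd p \<and> snd p < h (fst p)}"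
  have DU: "open (D \<times> (UNIV :: real set))" using D(1) by (simp add: open_Times)
  have "continuous_on (D \<times> UNIV) (\<lambda>p. snd p - l (fst p))" "continuous_on (D \<times> UNIV) (\<lambda>p. h (fst p) - snd p)"
    by (intro continuous_intros continuous_on_compose2[OF cont(1)] continuous_on_compose2[OF cont(2)]; auto)+
  from continuous_open_preimage[OF this(1) DU open_greaterThan[of 0]]
    continuous_open_preimage[OF this(2) DU open_greaterThan[of 0]]
  have "open ((D \<times> UNIV \<inter> (\<lambda>p. snd p - l (fst p)) -` {0<..}) \<inter> (D \<times> UNIV \<inter> (\<lambda>p. h (fst p) - snd p) -` {0<..}))"
    by (rule open_Int)
  also have "((D \<times> UNIV \<inter> (\<lambda>p. snd p - l (fst p)) -` {0<..}) \<inter> (D \<times> UNIV \<inter> (\<lambda>p. h (fst p) - snd p) -` {0<..})) = S"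
    unfolding S_def by auto
  finally have "S \<in> sets borel" by simp
  moreover have "bounded S"
  proof (rule bounded_subset)
    show "bounded (D \<times> {- M..M})" using D(2) by (simp add: bounded_Times)
    show "S \<subseteq> D \<times> {- M..M}" unfolding S_def using lh by force
  qed
  moreover have "(\<lambda>p :: 'a \<times> real. w (snd p)) \<in> borel_measurable borel"
    using w by (intro measurable_compose[OF _ w] borel_measurable_continuous_onI continuous_intros)
  ultimately have "set_integrable lborel S (\<lambda>p. w (snd p))"
    using bound by (rule set_integrable_bounded_measurable) (auto simp: S_def)
  then have int: "integrable (lborel \<Otimes>\<^sub>M lborel) (\<lambda>p. indicator S p *\<^sub>R w (snd p))"
    unfolding set_integrable_def by (simp add: lborel_prod)
  have slice: "(LINT t|lborel. indicator S (x, t) *\<^sub>R w (snd (x, t)))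
      = indicator D x *\<^sub>R (LINT t:{l x<..<h x}|lborel. w t)" for x
    by (cases "x \<in> D") (auto simp: S_def set_lebesgue_integral_def indicator_def)
  show "set_integrable lborel D (\<lambda>x. LINT t:{l x<..<h x}|lborel. w t)"
    using lborel_pair.integrable_fst'[OF int] unfolding slice set_integrable_def .
  show "(LINT p:{p. fst p \<in> D \<and> l (fst p) < snd p \<and> snd p < h (fst p)}|lborel. w (snd p))
      = (LINT x:D|lborel. LINT t:{l x<..<h x}|lborel. w t)"
    using lborel_pair.integral_fst'[OF int]
    unfolding slice S_def[symmetric] set_lebesgue_integral_def[of _ D] set_lebesgue_integral_def[of _ S]
    by (simp add: lborel_prod)
qed

text \<open>The interval integral is oriented, so it changes sign for \<open>s < 0\<close>, in accordance with the sign
  of the part of the enclosed domain below height \<open>0\<close>.\<close>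

definition potential :: "(real \<Rightarrow> real) \<Rightarrow> real \<Rightarrow> real" where
  "potential w s = (LBINT t=ereal 0..ereal s. w t)"

lemma potential_eq:
  "potential w s = (LINT t:{0<..<s}|lborel. w t) - (LINT t:{s<..<0}|lborel. w t)"
  by (simp add: potential_def interval_lebesgue_integral_def set_lebesgue_integral_def)

lemma potential_const: "potential (\<lambda>_. 1) s = s"
  by (cases "0 \<le> s") (simp_all add: potential_eq set_lebesgue_integral_def)

lemma enclosed_integral_eq:
  fixes D :: "(real^'n::finite) set" and w :: "real \<Rightarrow> real"
  assumes D: "open D" "bounded D" and g: "continuous_on D g" "\<And>x. x \<in> D \<Longrightarrow> \<bar>g x\<bar> \<le> M"
    and w: "w \<in> borel_measurable borel"
    and bound: "\<And>x t. x \<in> D \<Longrightarrow> min 0 (g x) < t \<Longrightarrow> t < max 0 (g x) \<Longrightarrow> \<bar>w t\<bar> \<le> B"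
  shows "set_integrable lborel D (\<lambda>x. potential w (g x))"
    and "enclosed_integral \<sigma> D g (\<lambda>p. w (snd p)) = \<sigma> * (LINT x:D|lborel. potential w (g x))"
proof -
  have M: "- \<bar>M\<bar> \<le> g x" "g x \<le> \<bar>M\<bar>" if "x \<in> D" for x using g(2)[OF that] by auto
  have c0: "continuous_on D (\<lambda>_. 0::real)" by simp
  have pos: "set_integrable lborel D (\<lambda>x. LINT t:{0<..<g x}|lborel. w t)"
    "(LINT p:{p. fst p \<in> D \<and> 0 < snd p \<and> snd p < g (fst p)}|lborel. w (snd p))
      = (LINT x:D|lborel. LINT t:{0<..<g x}|lborel. w t)"
    by (rule set_integral_between_graphs[OF D c0 g(1), of "\<bar>M\<bar>" w B]; use M w bound in auto)+
  have neg: "set_integrable lborel D (\<lambda>x. LINT t:{g x<..<0}|lborel. w t)"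
    "(LINT p:{p. fst p \<in> D \<and> g (fst p) < snd p \<and> snd p < 0}|lborel. w (snd p))
      = (LINT x:D|lborel. LINT t:{g x<..<0}|lborel. w t)"
    by (rule set_integral_between_graphs[OF D g(1) c0, of "\<bar>M\<bar>" w B]; use M w bound in auto)+
  show "set_integrable lborel D (\<lambda>x. potential w (g x))"
    unfolding potential_eq by (rule set_integral_diff(1)[OF pos(1) neg(1)])
  show "enclosed_integral \<sigma> D g (\<lambda>p. w (snd p)) = \<sigma> * (LINT x:D|lborel. potential w (g x))"
    unfolding potential_eq enclosed_integral_def pos(2) neg(2) set_integral_diff(2)[OF pos(1) neg(1)] ..
qed

text \<open>The left-hand side is the oriented integral of \<open>w\<close> from \<open>a\<close> to \<open>b\<close>, whose integrand is compared with
  the constant \<open>w a\<close>.  The bound for \<open>w\<close> has to reach \<open>0\<close>, where both potentials start.\<close>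

lemma potential_above_tangent:
  assumes w: "w \<in> borel_measurable borel"
    and bound: "\<And>t. min 0 (min a b) < t \<Longrightarrow> t < max 0 (max a b) \<Longrightarrow> \<bar>w t\<bar> \<le> B"
    and up: "\<And>t. a < t \<Longrightarrow> t < b \<Longrightarrow> w a \<le> w t" and down: "\<And>t. b < t \<Longrightarrow> t < a \<Longrightarrow> w t \<le> w a"
  shows "potential w b - potential w a \<ge> w a * (b - a)"
proof -
  have int: "set_integrable lborel {c<..<d} w"
    if "min 0 (min a b) \<le> c" "d \<le> max 0 (max a b)" for c d
    by (rule set_integrable_bounded_measurable[where B=B]) (use that w bound in auto)
  define lo hi where "lo = min 0 (min a b)" and "hi = max 0 (max a b)"
  have "lo \<le> hi" "set_integrable lborel {lo<..<hi} w"
    using int[of lo hi] by (auto simp: lo_def hi_def)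
  then have "interval_lebesgue_integrable lborel (ereal lo) (ereal hi) w"
    by (simp add: interval_lebesgue_integrable_def)
  moreover have "ereal lo = min (ereal 0) (min (ereal a) (ereal b))"
    "ereal hi = max (ereal 0) (max (ereal a) (ereal b))"
    by (simp_all add: lo_def hi_def)
  ultimately have "interval_lebesgue_integrable lborel (min (ereal 0) (min (ereal a) (ereal b)))
      (max (ereal 0) (max (ereal a) (ereal b))) w"
    by simp
  from interval_integral_sum[OF this]
  have diff: "potential w b - potential w a = (LBINT t=ereal a..ereal b. w t)"
    unfolding potential_def by linarith
  have const: "set_integrable lborel {c<..<d} (\<lambda>_. w a)" for c d :: real
    by (rule set_integrable_bounded_measurable[where B="\<bar>w a\<bar>"]) auto
  have cint: "(LINT t:{c<..<d}|lborel. w a) = w a * (d - c)" if "c \<le> d" for c d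
    using that by (simp add: set_lebesgue_integral_def)
  show ?thesis
  proof (cases "a \<le> b")
    case True
    have "w a * (b - a) = (LINT t:{a<..<b}|lborel. w a)" by (simp add: cint True)
    also have "\<dots> \<le> (LINT t:{a<..<b}|lborel. w t)"
      by (intro set_integral_mono const int up) auto
    finally show ?thesis using True by (simp add: diff interval_lebesgue_integral_def)
  next
    case False
    have "(LINT t:{b<..<a}|lborel. w t) \<le> (LINT t:{b<..<a}|lborel. w a)"
      by (intro set_integral_mono const int down) auto
    also have "\<dots> = w a * (a - b)" using False by (simp add: cint)
    finally show ?thesis using False by (simp add: diff interval_lebesgue_integral_def algebra_simps)
  qed
qed

lemma height_power_mono:
  assumes "admissible_height m a" "a \<le> b" "m > 0"
  shows "height_power a m \<le> height_power b m"
  using assms(1,3)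
proof (cases rule: admissible_height_cases)
  case (power k)
  show ?thesis
  proof (cases "even (Suc k)")
    case True
    then show ?thesis using power assms(2) by (simp only: power(1) height_power_of_nat) (rule power_mono; simp)
  next
    case False
    then show ?thesis using assms(2) by (simp only: power(1) height_power_of_nat) (rule power_mono_odd)
  qed
next
  case powr
  then show ?thesis using assms(2,3) by (simp add: height_power_def powr_mono2)
qed

lemma height_power_bound:
  assumes "m \<notin> \<nat> \<Longrightarrow> 0 \<le> t" "\<bar>t\<bar> \<le> M" "m > 0"
  shows "\<bar>height_power t m\<bar> \<le> height_power M m"
proof (cases "m \<in> \<nat>")
  case True
  then obtain k where "m = real k" by (auto elim: Nats_cases)
  then show ?thesis using assms(2) by (simp add: power_abs power_mono)
next
  case False
  then show ?thesis using assms by (simp add: height_power_def powr_mono2)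
qed

lemma height_power_measurable: "(\<lambda>t. height_power t m) \<in> borel_measurable borel"
  by (cases "m \<in> \<nat>") (simp_all add: height_power_def)

text \<open>Admissibility keeps the density \<open>height_power t m\<close> bounded between height \<open>0\<close> and the
  graph, since for \<open>m \<notin> \<nat>\<close> only nonnegative heights occur there.\<close>

lemma energy_eq:
  fixes D :: "(real^'n::finite) set"
  assumes D: "open D" "bounded D" and g: "continuous_on D g" "\<And>x. x \<in> D \<Longrightarrow> \<bar>g x\<bar> \<le> M"
    and adm: "\<And>x. x \<in> D \<Longrightarrow> admissible_height m (g x)" and m: "m > 0"
  shows "set_integrable lborel D (\<lambda>x. potential (\<lambda>t. height_power t m) (g x))"
    and "set_integrable lborel D g"
    and "energy \<eta> m lam \<sigma> D g = (LINT x:D|lborel. area_element (graph_param g) x)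
      + \<eta> * (\<sigma> * (LINT x:D|lborel. potential (\<lambda>t. height_power t m) (g x)))
      + lam * (\<sigma> * (LINT x:D|lborel. g x))"
proof -
  have bound: "\<bar>height_power t m\<bar> \<le> height_power M m"
    if x: "x \<in> D" "min 0 (g x) < t" "t < max 0 (g x)" for x t
  proof (rule height_power_bound[OF _ _ m])
    show "\<bar>t\<bar> \<le> M" using x g(2)[OF x(1)] by auto
    show "0 \<le> t" if "m \<notin> \<nat>" using adm[OF x(1)] that x(2) by (auto simp: admissible_height_def)
  qed
  have h: "set_integrable lborel D (\<lambda>x. potential (\<lambda>t. height_power t m) (g x))"
    "enclosed_integral \<sigma> D g (\<lambda>p. height_power (snd p) m)
      = \<sigma> * (LINT x:D|lborel. potential (\<lambda>t. height_power t m) (g x))"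
    using enclosed_integral_eq[OF D g, of "\<lambda>t. height_power t m" "height_power M m"]
      height_power_measurable bound g(2) by blast+
  note one = enclosed_integral_eq[OF D g, of "\<lambda>_. 1" 1, unfolded potential_const, simplified]
  show "set_integrable lborel D (\<lambda>x. potential (\<lambda>t. height_power t m) (g x))" by (rule h(1))
  show "set_integrable lborel D g" by (rule one(1))
  show "energy \<eta> m lam \<sigma> D g = (LINT x:D|lborel. area_element (graph_param g) x)
      + \<eta> * (\<sigma> * (LINT x:D|lborel. potential (\<lambda>t. height_power t m) (g x)))
      + lam * (\<sigma> * (LINT x:D|lborel. g x))"
    using h(2) one(2)[of \<sigma>] by (simp add: energy_def)
qed

text \<open>Admissible heights form an interval on which the density is increasing.\<close>

lemma height_potential_above_tangent:
  assumes "admissible_height m a" "admissible_height m b" "m > 0"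
  shows "potential (\<lambda>t. height_power t m) b - potential (\<lambda>t. height_power t m) a
    \<ge> height_power a m * (b - a)"
proof (rule potential_above_tangent[OF height_power_measurable])
  show "\<bar>height_power t m\<bar> \<le> height_power (max \<bar>a\<bar> \<bar>b\<bar>) m"
    if "min 0 (min a b) < t" "t < max 0 (max a b)" for t
  proof (rule height_power_bound[OF _ _ assms(3)])
    show "\<bar>t\<bar> \<le> max \<bar>a\<bar> \<bar>b\<bar>" using that by auto
    show "0 \<le> t" if "m \<notin> \<nat>"
      using assms(1,2) that \<open>min 0 (min a b) < t\<close> by (auto simp: admissible_height_def)
  qed
  show "height_power a m \<le> height_power t m" if "a < t" "t < b" for t
    by (rule height_power_mono) (use assms that in auto)
  show "height_power t m \<le> height_power a m" if "b < t" "t < a" for t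
  proof (rule height_power_mono)
    show "admissible_height m t" using assms(2) that by (auto simp: admissible_height_def intro: less_trans)
  qed (use assms that in auto)
qed

text \<open>This is the Cauchy--Schwarz inequality for the normal vectors \<open>(1, grad f x)\<close> and \<open>(1, grad g x)\<close>,
  and expresses the convexity of the area density in the gradient.\<close>

lemma slope_factor_above_tangent:
  "slope_factor g x \<ge> slope_factor f x + normal_slope f x \<bullet> (grad g x - grad f x)"
proof -
  let ?p = "grad f x" and ?q = "grad g x"
  have "(1::real, ?p) \<bullet> (1, ?q) \<le> norm (1::real, ?p) * norm (1::real, ?q)" by (rule norm_cauchy_schwarz)
  then have "1 + ?p \<bullet> ?q \<le> slope_factor f x * slope_factor g x"
    by (simp add: norm_Pair slope_factor_def)
  moreover have "slope_factor f x * (slope_factor f x + normal_slope f x \<bullet> (?q - ?p)) = 1 + ?p \<bullet> ?q"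
  proof -
    have "slope_factor f x * (normal_slope f x \<bullet> v) = ?p \<bullet> v" for v
      by (simp add: normal_slope_def slope_factor_nonzero)
    then show ?thesis
      using slope_factor_sq[of f x]
      by (simp add: distrib_left right_diff_distrib inner_diff_right power2_norm_eq_inner
          power2_eq_square[of "slope_factor f x"])
  qed
  ultimately show ?thesis
    using slope_factor_pos[of f x] by (metis mult_le_cancel_left_pos)
qed

section \<open>Minimality\<close>

context smooth_graph
begin

lemma graph_of_finite_area:
  assumes "compact K" "K \<subseteq> U"
  shows "set_integrable lborel (interior K) (area_element (graph_param f))"
proof -
  have "set_integrable lborel (interior K) W"
    using smooth_on_continuous[OF smooth_W] continuous_on_subset[OF _ assms(2)] interior_subset
    by (intro set_integrable_continuous_compact[OF assms(1)]) auto
  then show ?thesis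
    using assms(2) interior_subset[of K]
    by (subst set_integrable_cong[where f'=W]) (auto simp: area_element_graph differentiable_f)
qed

text \<open>The graph of \<open>f\<close> is calibrated by its normal field: the first-order lower bounds for the area and
  the potential energy of \<open>g\<close> add up, by the stationarity of \<open>f\<close>, to the divergence of
  \<open>(g - f) X\<close>.\<close>

proposition energy_le_of_stationary:
  assumes K: "compact_domain K" "K \<subseteq> U"
    and st: "stationary \<eta> m lam (interior K) (graph_param f) (graph_normal \<sigma> f)"
    and \<sigma>: "\<sigma> * \<sigma> = 1" and pos: "\<eta> * \<sigma> > 0" and m: "m > 0"
    and adm: "\<And>x. x \<in> K \<Longrightarrow> admissible_height m (f x)"
    and g: "g \<in> graphs_with_boundary m K f"
  shows "energy \<eta> m lam \<sigma> (interior K) f \<le> energy \<eta> m lam \<sigma> (interior K) g"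
proof -
  define D where "D = interior K"
  have cK: "compact K" and clD: "closure D = K"
    using K(1) by (auto simp: compact_domain_def D_def)
  have D: "open D" "bounded D" "D \<subseteq> K" "D \<subseteq> U" "D \<in> sets borel"
    using K(2) interior_subset[of K] bounded_subset[OF compact_imp_bounded[OF cK]] unfolding D_def
    by auto
  have frD: "x \<in> K \<and> x \<in> frontier K" if "x \<in> frontier D" for x
    using that clD D(1) cK by (simp add: frontier_def interior_open D_def compact_imp_closed closure_closed)
  have fK: "continuous_on K f" using smooth_on_continuous[OF smooth_f] K(2) continuous_on_subset by blast
  have gK: "continuous_on K g" and gC1: "Ck_on 1 D g"
    and gint: "set_integrable lborel D (area_element (graph_param g))"
    and gadm: "\<And>x. x \<in> K \<Longrightarrow> admissible_height m (g x)"
    and gbd: "\<And>x. x \<in> frontier K \<Longrightarrow> g x = f x"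
    using g by (auto simp: graphs_with_boundary_def D_def)
  have dg: "g differentiable (at x)" if "x \<in> D" for x using gC1 that by (simp add: One_nat_def)
  have df: "f differentiable (at x)" if "x \<in> D" for x using that D(4) differentiable_f by blast
  have fint: "set_integrable lborel D (area_element (graph_param f))"
    unfolding D_def by (rule graph_of_finite_area[OF cK K(2)])
  let ?Z = "\<lambda>y. (g y - f y) *\<^sub>R X y"

  \<comment> \<open>The derivatives of \<open>g\<close> may blow up at the frontier; they are integrable because the area
    density dominates them and \<open>g\<close> has finite area.\<close>
  have ZC1: "Ck_on 1 D (\<lambda>y. ?Z y $ i)" for i
  proof -
    have "Ck_on 1 D f" "Ck_on 1 D (\<lambda>y. X y $ i)"
      using Ck_on_subset[OF _ D(4)] smooth_f smooth_X unfolding smooth_on_def by blast+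
    then have "Ck_on 1 D (\<lambda>y. (g y + (- 1) * f y) * X y $ i)"
      by (intro Ck_on_mult Ck_on_add Ck_on_const gC1 D(1))
    then show ?thesis by simp
  qed
  have Zint: "set_integrable lborel D (pd i (\<lambda>y. ?Z y $ i))" for i
  proof -
    have cX: "continuous_on K (\<lambda>x. X x $ i)" "continuous_on K (pd i (\<lambda>x. X x $ i))"
      using smooth_on_continuous[OF smooth_X] smooth_on_continuous[OF smooth_on_pd[OF smooth_X]]
        continuous_on_subset[OF _ K(2)] by blast+
    have 1: "set_integrable lborel D (\<lambda>x. (g x - f x) * pd i (\<lambda>x. X x $ i) x)"
      by (intro set_integrable_continuous_compact[OF cK _ D(3,5)] continuous_intros gK fK cX)
    have 2: "set_integrable lborel D (\<lambda>x. (pd i g x - pd i f x) * X x $ i)"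
    proof (rule set_integrable_bound)
      show "set_integrable lborel D (\<lambda>x. area_element (graph_param g) x + area_element (graph_param f) x)"
        by (rule set_integral_add(1)[OF gint fint])
      have "continuous_on D (pd i g)" using gC1 by (simp add: One_nat_def)
      moreover have "continuous_on D (pd i f)"
        using smooth_on_continuous[OF smooth_on_pd[OF smooth_f]] continuous_on_subset[OF _ D(4)] by blast
      ultimately have "continuous_on D (\<lambda>x. (pd i g x - pd i f x) * X x $ i)"
        by (intro continuous_intros continuous_on_subset[OF cX(1) D(3)])
      then show "set_borel_measurable lborel D (\<lambda>x. (pd i g x - pd i f x) * X x $ i)"
        using borel_measurable_continuous_on_indicator[OF D(5), of "\<lambda>x. (pd i g x - pd i f x) * X x $ i"]
        by (simp add: set_borel_measurable_def)
      have le: "\<bar>pd i h x\<bar> \<le> slope_factor h x" for h and x :: "real^'n"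
      proof -
        have "\<bar>pd i h x\<bar> \<le> norm (grad h x)" using component_le_norm_cart[of "grad h x" i] by (simp add: grad_def)
        also have "\<dots> \<le> slope_factor h x" unfolding slope_factor_def by (rule real_le_rsqrt) simp
        finally show ?thesis .
      qed
      have "\<bar>(pd i g x - pd i f x) * X x $ i\<bar> \<le> slope_factor g x + slope_factor f x" for x
      proof -
        have "\<bar>X x $ i\<bar> \<le> 1"
          using component_le_norm_cart[of "X x" i] norm_normal_slope_less_1[of f x] by linarith
        then have "\<bar>(pd i g x - pd i f x) * X x $ i\<bar> \<le> \<bar>pd i g x - pd i f x\<bar>"
          by (simp add: abs_mult mult_left_le)
        also have "\<dots> \<le> slope_factor g x + slope_factor f x"
          using le[of g x] le[of f x] by linarith
        finally show ?thesis .
      qed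
      then show "AE x in lborel. x \<in> D \<longrightarrow> norm ((pd i g x - pd i f x) * X x $ i)
          \<le> norm (area_element (graph_param g) x + area_element (graph_param f) x)"
        using dg df by (auto simp: area_element_graph intro!: AE_I2 order_trans[OF _ abs_ge_self])
    qed
    have "pd i (\<lambda>y. ?Z y $ i) x = (g x - f x) * pd i (\<lambda>x. X x $ i) x + (pd i g x - pd i f x) * X x $ i"
      if "x \<in> D" for x
      using that D(4) smooth_on_differentiable[OF smooth_X] dg df
      by (simp add: pd_mult pd_diff differentiable_diff subset_iff)
    then show ?thesis
      using set_integral_add(1)[OF 1 2] by (subst set_integrable_cong) auto
  qed
  have Z: "set_integrable lborel D (divergence ?Z)" "(LINT x:D|lborel. divergence ?Z x) = 0"
  proof -
    have 1: "continuous_on (closure D) (\<lambda>y. ?Z y $ i)" for i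
    proof -
      have "continuous_on K (\<lambda>y. X y $ i)"
        using smooth_on_continuous[OF smooth_X] continuous_on_subset[OF _ K(2)] by blast
      then show ?thesis
        using gK fK unfolding clD vector_scaleR_component real_scaleR_def
        by (intro continuous_on_mult continuous_on_diff)
    qed
    have 2: "?Z x = 0" if "x \<in> frontier D" for x using gbd frD[OF that] by simp
    have 3: "(\<lambda>y. ?Z y $ i) differentiable (at x)" if "x \<in> D" for i x
      using ZC1[of i] that by (simp add: One_nat_def)
    have 4: "continuous_on D (pd i (\<lambda>y. ?Z y $ i))" for i
      using ZC1[of i] by (simp add: One_nat_def)
    show "set_integrable lborel D (divergence ?Z)" "(LINT x:D|lborel. divergence ?Z x) = 0"
      using integral_divergence_zero[OF D(1,2) 1 2 3 4 Zint] by blast+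
  qed

  obtain M where "\<And>x. x \<in> K \<Longrightarrow> \<bar>g x\<bar> \<le> M"
    using compact_continuous_image[OF gK cK, THEN compact_imp_bounded]
    unfolding bounded_iff by (auto simp: real_norm_def)
  moreover obtain M' where "\<And>x. x \<in> K \<Longrightarrow> \<bar>f x\<bar> \<le> M'"
    using compact_continuous_image[OF fK cK, THEN compact_imp_bounded]
    unfolding bounded_iff by (auto simp: real_norm_def)
  ultimately have bdd: "\<And>x. x \<in> D \<Longrightarrow> \<bar>g x\<bar> \<le> M" "\<And>x. x \<in> D \<Longrightarrow> \<bar>f x\<bar> \<le> M'"
    using D(3) by blast+
  let ?P = "potential (\<lambda>t. height_power t m)"
  have admD: "\<And>x. x \<in> D \<Longrightarrow> admissible_height m (g x)" "\<And>x. x \<in> D \<Longrightarrow> admissible_height m (f x)"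
    using adm gadm D(3) by blast+
  note eg = energy_eq[OF D(1,2) continuous_on_subset[OF gK D(3)] bdd(1) admD(1) m]
  note ef = energy_eq[OF D(1,2) continuous_on_subset[OF fK D(3)] bdd(2) admD(2) m]
  define \<Delta> where "\<Delta> x = (area_element (graph_param g) x - area_element (graph_param f) x)
    + (\<eta> * \<sigma> * (?P (g x) - ?P (f x)) + lam * \<sigma> * (g x - f x))" for x
  have ints: "set_integrable lborel D (\<lambda>x. area_element (graph_param g) x - area_element (graph_param f) x)"
    "set_integrable lborel D (\<lambda>x. \<eta> * \<sigma> * (?P (g x) - ?P (f x)))"
    "set_integrable lborel D (\<lambda>x. lam * \<sigma> * (g x - f x))"
    using set_integral_diff(1)[OF gint fint] set_integral_diff(1)[OF eg(1) ef(1)]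
      set_integral_diff(1)[OF eg(2) ef(2)] by (auto intro!: set_integrable_mult_right)
  have \<Delta>int: "set_integrable lborel D \<Delta>"
    unfolding \<Delta>_def[abs_def] by (intro set_integral_add ints)
  have "(LINT x:D|lborel. divergence ?Z x) \<le> (LINT x:D|lborel. \<Delta> x)"
  proof (rule set_integral_mono[OF Z(1) \<Delta>int])
    fix x assume x: "x \<in> D"
    then have xU: "x \<in> U" using D(4) by blast
    have "grad (\<lambda>y. g y - f y) x = grad g x - grad f x"
      using x dg df by (simp add: grad_def vec_eq_iff pd_diff)
    then have "divergence ?Z x = (g x - f x) * divergence X x + X x \<bullet> (grad g x - grad f x)"
      using divergence_scaleR[of "\<lambda>y. g y - f y" x X] x dg df smooth_on_differentiable[OF smooth_X xU]
      by (simp add: differentiable_diff inner_commute)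
    also have "\<dots> = X x \<bullet> (grad g x - grad f x)
        + (\<eta> * \<sigma> * (height_power (f x) m * (g x - f x)) + lam * \<sigma> * (g x - f x))"
      using stationary_divergence[OF st[folded D_def] \<sigma> D(4) x] by (simp add: algebra_simps)
    also have "\<dots> \<le> (slope_factor g x - slope_factor f x)
        + (\<eta> * \<sigma> * (?P (g x) - ?P (f x)) + lam * \<sigma> * (g x - f x))"
      using slope_factor_above_tangent[where f=f and g=g and x=x]
        mult_left_mono[OF height_potential_above_tangent[OF admD(2)[OF x] admD(1)[OF x] m], of "\<eta> * \<sigma>"] pos
      by linarith
    also have "\<dots> = \<Delta> x" using x dg df by (simp add: \<Delta>_def area_element_graph)
    finally show "divergence ?Z x \<le> \<Delta> x" .
  qed
  also have "(LINT x:D|lborel. \<Delta> x) = energy \<eta> m lam \<sigma> D g - energy \<eta> m lam \<sigma> D f"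
    unfolding \<Delta>_def using ints gint fint eg(1,2) ef(1,2)
    by (simp add: set_integral_add set_integral_diff eg(3) ef(3) algebra_simps)
  finally show ?thesis using Z(2) by (simp add: D_def)
qed

end

theorem theorem3p5:
  fixes K :: "(real^'n::finite) set" and f :: "real^'n \<Rightarrow> real"
    and \<eta> m lam \<sigma> :: real
  assumes "compact_domain K"
    and "smooth_up_to_boundary K f"
    and "m > 0" and "\<eta> \<noteq> 0"
    and "\<forall>x\<in>K. admissible_height m (f x)"
    and "\<sigma> = 1 \<or> \<sigma> = - 1"
    and "stationary \<eta> m lam (interior K) (graph_param f) (graph_normal \<sigma> f)"
    and "\<forall>x\<in>K. \<eta> * snd (graph_normal \<sigma> f x) > 0"
  shows "stable \<eta> m lam (interior K) (graph_param f) (graph_normal \<sigma> f)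
    \<and> f \<in> graphs_with_boundary m K f
    \<and> (\<forall>g\<in>graphs_with_boundary m K f.
          energy \<eta> m lam \<sigma> (interior K) f \<le> energy \<eta> m lam \<sigma> (interior K) g)"
proof -
  obtain U where U: "open U" "K \<subseteq> U" "smooth_on U f"
    using assms(2) unfolding smooth_up_to_boundary_def by blast
  interpret smooth_graph U f by unfold_locales (rule U)+
  have K: "compact K" "K \<noteq> {}" "closure (interior K) = K"
    using assms(1) by (auto simp: compact_domain_def)
  have \<sigma>: "\<sigma> * \<sigma> = 1" using assms(6) by auto
  obtain x where "x \<in> K" using K(2) by blast
  then have "\<eta> * \<sigma> / W x > 0" using assms(8) by (simp add: graph_normal_eq)
  then have pos: "\<eta> * \<sigma> > 0" using slope_factor_pos[of f x] by (simp add: zero_less_divide_iff)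
  have "second_variation \<eta> m (interior K) (graph_param f) (graph_normal \<sigma> f) u \<ge> 0"
    if "test_function (interior K) u" for u
  proof (rule second_variation_nonneg[OF assms(7) \<sigma> open_interior _ _ _ assms(3) pos that])
    show "admissible_height m (f x)" if "x \<in> interior K" for x
      using assms(5) that interior_subset by blast
  qed (use K U(2) in simp_all)
  then have "stable \<eta> m lam (interior K) (graph_param f) (graph_normal \<sigma> f)"
    using assms(7) by (simp add: stable_def)
  moreover have "f \<in> graphs_with_boundary m K f"
  proof -
    have "Ck_on 1 (interior K) f"
      using U(2,3) interior_subset[of K] Ck_on_subset unfolding smooth_on_def by blast
    moreover have "continuous_on K f"
      using smooth_on_continuous[OF U(3)] U(2) continuous_on_subset by blast
    ultimately show ?thesis
      using graph_of_finite_area[OF K(1) U(2)] assms(5) by (simp add: graphs_with_boundary_def)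
  qed
  moreover have "energy \<eta> m lam \<sigma> (interior K) f \<le> energy \<eta> m lam \<sigma> (interior K) g"
    if "g \<in> graphs_with_boundary m K f" for g
    by (rule energy_le_of_stationary[OF assms(1) U(2) assms(7) \<sigma> pos assms(3) _ that]) (use assms(5) in blast)
  ultimately show ?thesis by blast
qed

end
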